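(* Let $C \in \mathbb{C}^{n \times n}$. Then $C$ is complex symmetric and semi-sectorial if and only if there exists a nonsingular real matrix $T \in \mathbb{R}^{n \times n}$ such that $$C = T^T \begin{bmatrix} 0_{n-r} & 0 & 0 \\ 0 & D & 0 \\ 0 & 0 & E \end{bmatrix} T ,$$ where $r = \mathrm{rank}(C)$, $D = \mathrm{diag}\{e^{j\phi_1}, \dots, e^{j\phi_m}\}$ with $\theta_0 + \frac{\pi}{2} \geq \phi_1 \geq \cdots \geq \phi_m \geq \theta_0 - \frac{\pi}{2}$, and $$E = e^{j\theta_0}\, \mathrm{diag}\left\{ \begin{bmatrix} 0 & -j \\ -j & 1 \end{bmatrix}, \dots, \begin{bmatrix} 0 & -j \\ -j & 1 \end{bmatrix} \right\},$$ for some $\theta_0 \in \mathbb{R}$.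
   Context: Here $j$ is the imaginary unit, $(\cdot)^T$ is the transpose and $(\cdot)^H$ the conjugate transpose. A matrix $C \in \mathbb{C}^{n\times n}$ is complex symmetric if $C = C^T$. Its numerical range is $W(C) = \{x^H C x : x \in \mathbb{C}^n, \|x\| = 1\}$, with $\|x\|=\sqrt{x^Hx}$. The matrix $C$ is semi-sectorial if $W(C)$ is contained in a closed half complex plane (a closed half-plane whose boundary line passes through the origin). $0_{n-r}$ is the $(n-r)\times(n-r)$ zero matrix, $D$ is $m \times m$, and $E$ is block diagonal of size $(r-m)\times(r-m)$ with $\frac{r-m}{2}$ identical $2\times 2$ blocks; any of the three diagonal blocks $0_{n-r}$, $D$, $E$ may be absent (of size zero). *)

theory Defs
  imports Complex_Main "Jordan_Normal_Form.Matrix" "Jordan_Normal_Form.DL_Rank"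
begin

text \<open>
  As \<^term>\<open>u \<bullet>c v\<close> conjugates its second argument, \<open>x\<^sup>H y\<close> is written \<^term>\<open>y \<bullet>c x\<close>.
\<close>

definition euclidean_norm :: "complex vec \<Rightarrow> real" where
  "euclidean_norm x = sqrt (Re (x \<bullet>c x))"

definition numerical_range :: "nat \<Rightarrow> complex mat \<Rightarrow> complex set" where
  "numerical_range n C =
     {(C *\<^sub>v x) \<bullet>c x | x. x \<in> carrier_vec n \<and> euclidean_norm x = 1}"

definition complex_symmetric :: "complex mat \<Rightarrow> bool" where
  "complex_symmetric C \<longleftrightarrow> C = C\<^sup>T"

text \<open>
  \<^term>\<open>Re (cnj a * z)\<close> is the real inner product of \<open>a\<close> and \<open>z\<close> in the plane, so for \<open>a \<noteq> 0\<close>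
  this is the closed half-plane with inner normal \<open>a\<close> whose boundary line passes through the origin.
\<close>

definition closed_half_plane :: "complex \<Rightarrow> complex set" where
  "closed_half_plane a = {z. Re (cnj a * z) \<ge> 0}"

definition semi_sectorial :: "nat \<Rightarrow> complex mat \<Rightarrow> bool" where
  "semi_sectorial n C \<longleftrightarrow>
     (\<exists>a. a \<noteq> 0 \<and> numerical_range n C \<subseteq> closed_half_plane a)"

text \<open>Indices start at 0: \<open>\<phi> i\<close> is the angle \<open>\<phi>\<^sub>i\<^sub>+\<^sub>1\<close>.\<close>

definition D_block :: "nat \<Rightarrow> (nat \<Rightarrow> real) \<Rightarrow> complex mat" where
  "D_block m \<phi> = mat_diag m (\<lambda>i. cis (\<phi> i))"

definition E_block :: "real \<Rightarrow> nat \<Rightarrow> complex mat" where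
  "E_block \<theta> k =
     cis \<theta> \<cdot>\<^sub>m diag_block_mat (replicate k (mat_of_rows_list 2 [[0, - \<i>], [- \<i>, 1]]))"

end

theory Submission
  imports Defs "Jordan_Normal_Form.Schur_Decomposition" "Jordan_Normal_Form.Spectral_Radius"
begin

text \<open>
  After a rotation by \<open>-\<theta>\<^sub>0\<close> the numerical range lies in the right half-plane, i.e. the real part
  \<open>P\<close> of \<open>C = P + iQ\<close> is positive semidefinite. The pair \<open>(P, Q)\<close> is then reduced by real congruence,
  splitting off one block at a time and recursing on a complement. One may take \<open>P\<close> diagonal.
  A real \<open>v\<close> whose image \<open>C v\<close> is a complex multiple of a real vector splits off a line, provided
  that \<open>v\<^sup>T C v \<noteq> 0\<close> or \<open>C v = 0\<close>. Such \<open>v\<close> exists if \<open>Q\<close> does not vanish on \<open>ker P\<close>, if \<open>ker P\<close> and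
  \<open>ker Q\<close> intersect, or if \<open>P\<close> is definite (a generalized eigenvector \<open>Q v = \<lambda> P v\<close>). In the remaining
  case some \<open>v \<in> ker P\<close> has \<open>Q v \<noteq> 0\<close> orthogonal to \<open>ker P\<close>, so \<open>Q v = P w\<close>, and \<open>v, w\<close> span a plane that
  splits off as a cell of \<open>E\<close>.
\<close>

subsection \<open>Real congruence of complex matrices\<close>

text \<open>The obstacle is a singular \<open>P\<close>. For definite \<open>P\<close> the pair
  \<open>(P, Q)\<close> can be diagonalized by a real congruence; for semidefinite \<open>P\<close>
  this can fail, and a failure costs a plane instead of a line. To split off the line of
  \<open>v\<close>, each vector \<open>s\<close> of a complement is corrected by the multiple
  \<open>(v^T C s) / (v^T C v)\<close> of \<open>v\<close>, which has to be real for every real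
  \<open>s\<close>. This is the origin of the condition on \<open>C v\<close>. In the remaining case
  \<open>v^T C v = 0\<close> although \<open>C v\<close> is nonzero, so \<open>v\<close> alone
  cannot correct anything. The second vector \<open>w\<close> repairs this: after normalization the
  form on the plane has real part \<open>diag(0, 1)\<close> and imaginary part \<open>-1\<close> off
  the diagonal, which is the cell of \<open>E\<close>. Diagonal \<open>P\<close> makes
  \<open>ker P\<close> a coordinate subspace, so that \<open>P w = Q v\<close> is solved by dividing
  coordinates. The bound of \<open>pi / 2\<close> on the angles is nonnegativity of \<open>P\<close>
  on the split-off lines. The count \<open>n - r\<close> of zero lines follows because all other
  blocks are invertible.\<close>

abbreviation cmat :: "real mat \<Rightarrow> complex mat" where "cmat \<equiv> map_mat complex_of_real"
abbreviation cvec :: "real vec \<Rightarrow> complex vec" where "cvec \<equiv> map_vec complex_of_real"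

text \<open>For real \<open>S\<close> the transpose is also the conjugate transpose, so this one
  relation respects both the symmetry of a matrix and the values of its form
  \<open>x^H A x\<close>.\<close>

definition real_congruent :: "nat \<Rightarrow> complex mat \<Rightarrow> complex mat \<Rightarrow> bool" where
  "real_congruent n A B \<longleftrightarrow> A \<in> carrier_mat n n \<and>
     (\<exists>S \<in> carrier_mat n n. det S \<noteq> 0 \<and> B = cmat S\<^sup>T * A * cmat S)"

text \<open>Binary counterpart of \<open>diag_block_mat\<close>: the reduction peels off one summand
  at a time, while the normal form is a list of blocks.\<close>

definition direct_sum :: "'a :: zero mat \<Rightarrow> 'a mat \<Rightarrow> 'a mat" (infixr "\<oplus>\<^sub>d" 65) where
  "A \<oplus>\<^sub>d B = four_block_mat A (0\<^sub>m (dim_row A) (dim_col B)) (0\<^sub>m (dim_row B) (dim_col A)) B"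

lemma direct_sum_carrier [simp]:
  "A \<in> carrier_mat n n \<Longrightarrow> B \<in> carrier_mat m m \<Longrightarrow> A \<oplus>\<^sub>d B \<in> carrier_mat (n + m) (n + m)"
  by (simp add: direct_sum_def)

lemma diag_block_mat_Cons: "diag_block_mat (A # As) = A \<oplus>\<^sub>d diag_block_mat As"
  by (simp add: direct_sum_def Let_def)

lemma diag_block_mat_append_direct_sum:
  "diag_block_mat (As @ Bs) = diag_block_mat As \<oplus>\<^sub>d diag_block_mat Bs"
  by (simp add: diag_block_mat_append direct_sum_def Let_def)

lemma direct_sum_assoc: "A \<oplus>\<^sub>d (B \<oplus>\<^sub>d C) = (A \<oplus>\<^sub>d B) \<oplus>\<^sub>d C"
  unfolding direct_sum_def by (rule assoc_four_block_mat)

lemma direct_sum_mult: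
  fixes A :: "'a :: semiring_1 mat"
  assumes "A \<in> carrier_mat n n" "B \<in> carrier_mat m m" "A' \<in> carrier_mat n n" "B' \<in> carrier_mat m m"
  shows "(A \<oplus>\<^sub>d B) * (A' \<oplus>\<^sub>d B') = (A * A') \<oplus>\<^sub>d (B * B')"
  unfolding direct_sum_def
  by (subst mult_four_block_mat[of A n n _ m _ m _ A' n _ m]) (use assms in auto)

lemma direct_sum_transpose:
  assumes "A \<in> carrier_mat n n" "B \<in> carrier_mat m m"
  shows "(A \<oplus>\<^sub>d B)\<^sup>T = A\<^sup>T \<oplus>\<^sub>d B\<^sup>T"
  unfolding direct_sum_def
  by (subst transpose_four_block_mat[of A n n _ m _ m]) (use assms in auto)

lemma direct_sum_map:
  assumes "f 0 = 0"
  shows "map_mat f (A \<oplus>\<^sub>d B) = map_mat f A \<oplus>\<^sub>d map_mat f B"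
  by (rule eq_matI) (use assms in \<open>auto simp: direct_sum_def\<close>)

lemma direct_sum_mult_vec:
  fixes A :: "'a :: semiring_1 mat"
  assumes "A \<in> carrier_mat n n" "B \<in> carrier_mat m m" "x \<in> carrier_vec n" "y \<in> carrier_vec m"
  shows "(A \<oplus>\<^sub>d B) *\<^sub>v (x @\<^sub>v y) = (A *\<^sub>v x) @\<^sub>v (B *\<^sub>v y)"
  unfolding direct_sum_def
  by (subst four_block_mat_mult_vec[of A n n _ m _ m]) (use assms in auto)

lemma direct_sum_det:
  fixes A :: "'a :: idom mat"
  assumes "A \<in> carrier_mat n n" "B \<in> carrier_mat m m"
  shows "det (A \<oplus>\<^sub>d B) = det A * det B"
  unfolding direct_sum_def
  by (rule det_four_block_mat_lower_left_zero[of _ n _ m]) (use assms in auto)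

lemma ex_inverse_mat:
  fixes A :: "'a :: field mat"
  assumes "A \<in> carrier_mat n n" "det A \<noteq> 0"
  obtains B where "B \<in> carrier_mat n n" "A * B = 1\<^sub>m n" "B * A = 1\<^sub>m n"
  \<comment> \<open>\<open>undefined\<close> is a filler for the extension field of the record
    \<open>ring_mat\<close>.\<close>
  using det_non_zero_imp_unit[OF assms, of undefined]
  by (auto simp: Units_def ring_mat_def)

lemma invertible_mat_iff_det:
  fixes A :: "'a :: field mat"
  assumes "A \<in> carrier_mat n n"
  shows "invertible_mat A \<longleftrightarrow> det A \<noteq> 0"
proof
  assume "invertible_mat A"
  then obtain B where B: "A * B = 1\<^sub>m (dim_row A)" "B * A = 1\<^sub>m (dim_row B)"
    by (auto simp: invertible_mat_def inverts_mat_def)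
  \<comment> \<open>\<open>inverts_mat\<close> leaves the shape of \<open>B\<close> open; the
    identity matrices on the right-hand sides determine it.\<close>
  have "dim_col B = n" using arg_cong[OF B(1), of dim_col] assms by simp
  moreover have "dim_row B = n" using arg_cong[OF B(2), of dim_col] assms by simp
  ultimately have "det A * det B = 1"
    using B(1) assms by (metis carrier_matI carrier_matD(1) det_mult det_one)
  then show "det A \<noteq> 0" by auto
next
  assume "det A \<noteq> 0"
  from ex_inverse_mat[OF assms this] obtain B where
    "B \<in> carrier_mat n n" "A * B = 1\<^sub>m n" "B * A = 1\<^sub>m n" .
  then show "invertible_mat A" using assms by (auto simp: invertible_mat_def inverts_mat_def)
qed

lemma cmat_mult:
  "A \<in> carrier_mat n m \<Longrightarrow> B \<in> carrier_mat m l \<Longrightarrow> cmat (A * B) = cmat A * cmat B"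
  by (rule of_real_hom.mat_hom_mult)

lemma cmat_transpose: "cmat A\<^sup>T = (cmat A)\<^sup>T"
  by (rule eq_matI) auto

lemma real_congruentI:
  "A \<in> carrier_mat n n \<Longrightarrow> S \<in> carrier_mat n n \<Longrightarrow> det S \<noteq> 0 \<Longrightarrow>
    B = cmat S\<^sup>T * A * cmat S \<Longrightarrow> real_congruent n A B"
  by (auto simp: real_congruent_def)

lemma real_congruent_carrier:
  "real_congruent n A B \<Longrightarrow> A \<in> carrier_mat n n \<and> B \<in> carrier_mat n n"
  by (auto simp: real_congruent_def)

lemma real_congruent_refl: "A \<in> carrier_mat n n \<Longrightarrow> real_congruent n A A"
  by (rule real_congruentI[of _ _ "1\<^sub>m n"]) (auto simp: cmat_transpose of_real_hom.mat_hom_one)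

lemma real_congruent_trans:
  assumes "real_congruent n A B" "real_congruent n B C"
  shows "real_congruent n A C"
proof -
  from assms obtain S R where *: "A \<in> carrier_mat n n" "S \<in> carrier_mat n n" "det S \<noteq> 0"
    "R \<in> carrier_mat n n" "det R \<noteq> 0" "C = cmat R\<^sup>T * (cmat S\<^sup>T * A * cmat S) * cmat R"
    by (auto simp: real_congruent_def)
  have "C = cmat (S * R)\<^sup>T * A * cmat (S * R)"
    unfolding *(6) using *
    by (simp add: transpose_mult[of S n n] cmat_mult[of _ n n _ n] cmat_transpose assoc_mult_mat[of _ n n _ n _ n])
  then show ?thesis
    using * by (intro real_congruentI[of _ _ "S * R"]) (auto simp: det_mult)
qed

lemma real_congruent_sym:
  assumes "real_congruent n A B"
  shows "real_congruent n B A"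
proof -
  from assms obtain S where *: "A \<in> carrier_mat n n" "S \<in> carrier_mat n n" "det S \<noteq> 0"
    "B = cmat S\<^sup>T * A * cmat S"
    by (auto simp: real_congruent_def)
  obtain R where R: "R \<in> carrier_mat n n" "S * R = 1\<^sub>m n" "R * S = 1\<^sub>m n"
    using ex_inverse_mat[OF *(2,3)] .
  have "det S * det R = 1" using R * by (metis det_mult det_one)
  then have dR: "det R \<noteq> 0" by auto
  have 1: "cmat S * cmat R = 1\<^sub>m n"
    using R * by (simp flip: cmat_mult add: of_real_hom.mat_hom_one)
  have 2: "cmat R\<^sup>T * cmat S\<^sup>T = 1\<^sub>m n"
    using R * by (simp add: of_real_hom.mat_hom_one flip: cmat_mult[of _ n n _ n] transpose_mult[of S n n R n])
  have "cmat R\<^sup>T * B * cmat R = (cmat R\<^sup>T * cmat S\<^sup>T) * A * (cmat S * cmat R)"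
    unfolding *(4) using * R by (simp add: assoc_mult_mat[of _ n n _ n _ n])
  also have "\<dots> = A" using * by (simp add: 1 2)
  finally show ?thesis
    using * R dR by (intro real_congruentI[of _ _ R]) auto
qed

lemma real_congruent_direct_sum:
  assumes "real_congruent n A A'" "real_congruent m B B'"
  shows "real_congruent (n + m) (A \<oplus>\<^sub>d B) (A' \<oplus>\<^sub>d B')"
proof -
  from assms obtain S R where *: "A \<in> carrier_mat n n" "S \<in> carrier_mat n n" "det S \<noteq> 0"
    "A' = cmat S\<^sup>T * A * cmat S" "B \<in> carrier_mat m m"
    "R \<in> carrier_mat m m" "det R \<noteq> 0" "B' = cmat R\<^sup>T * B * cmat R"
    by (auto simp: real_congruent_def)
  show ?thesis
    by (rule real_congruentI[of _ _ "S \<oplus>\<^sub>d R"])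
      (use * in \<open>auto simp: direct_sum_transpose[of _ n _ m] direct_sum_map direct_sum_mult[of _ n _ m]
        direct_sum_det[of _ n _ m]\<close>)
qed

section \<open>Reordering diagonal blocks\<close>

lemma real_congruent_direct_sum_commute:
  assumes A: "A \<in> carrier_mat n n" and B: "B \<in> carrier_mat m m"
  shows "real_congruent (n + m) (A \<oplus>\<^sub>d B) (B \<oplus>\<^sub>d A)"
proof -
  \<comment> \<open>The permutation matrix exchanging the two coordinate blocks. Its determinant is
    a sign; \<open>S^T S = 1\<close> shows that it is nonzero without computing it.\<close>
  define S :: "real mat" where
    "S = four_block_mat (0\<^sub>m n m) (1\<^sub>m n) (1\<^sub>m m) (0\<^sub>m m n)"
  have S: "S \<in> carrier_mat (n + m) (m + n)"
    unfolding S_def by (rule four_block_carrier_mat) auto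
  have St: "S\<^sup>T = four_block_mat (0\<^sub>m m n) (1\<^sub>m m) (1\<^sub>m n) (0\<^sub>m n m)"
    unfolding S_def by (subst transpose_four_block_mat[of _ n m _ n _ m]) auto
  have c: "cmat S = four_block_mat (0\<^sub>m n m) (1\<^sub>m n) (1\<^sub>m m) (0\<^sub>m m n)"
    unfolding S_def by (subst map_four_block_mat[of _ n m _ n _ m])
      (auto simp: of_real_hom.mat_hom_one)
  have ct: "cmat S\<^sup>T = four_block_mat (0\<^sub>m m n) (1\<^sub>m m) (1\<^sub>m n) (0\<^sub>m n m)"
    unfolding St by (subst map_four_block_mat[of _ m n _ m _ n])
      (auto simp: of_real_hom.mat_hom_one)
  have 1: "S\<^sup>T * S = 1\<^sub>m (m + n)"
    unfolding St by (subst S_def, subst mult_four_block_mat[of _ m n _ m _ n _ _ m _ n]) auto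
  have "det S\<^sup>T * det S = 1"
    using 1 S by (metis add.commute det_mult det_one transpose_carrier_mat)
  then have d: "det S \<noteq> 0" by auto
  have "cmat S\<^sup>T * (A \<oplus>\<^sub>d B) = four_block_mat (0\<^sub>m m n) B A (0\<^sub>m n m)"
    unfolding ct direct_sum_def
    by (subst mult_four_block_mat[of _ m n _ m _ n _ _ n _ m]) (use A B in auto)
  moreover have "four_block_mat (0\<^sub>m m n) B A (0\<^sub>m n m) * cmat S = B \<oplus>\<^sub>d A"
    unfolding c direct_sum_def
    by (subst mult_four_block_mat[of _ m n _ m _ n _ _ m _ n]) (use A B in auto)
  ultimately have "B \<oplus>\<^sub>d A = cmat S\<^sup>T * (A \<oplus>\<^sub>d B) * cmat S" by simp
  then show ?thesis
    using direct_sum_carrier[OF A B] S d by (intro real_congruentI[of _ _ S]) (auto simp: add.commute)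
qed

lemma diag_block_mat_carrier:
  assumes "\<And>A. A \<in> set As \<Longrightarrow> dim_col A = dim_row A"
  shows "diag_block_mat As \<in> carrier_mat (sum_list (map dim_row As)) (sum_list (map dim_row As))"
proof -
  have "map dim_col As = map dim_row As" using assms by simp
  then show ?thesis by (intro carrier_matI) (simp_all only: dim_diag_block_mat)
qed

text \<open>The head \<open>A\<close> of \<open>As\<close> occurs in \<open>Bs\<close> as
  \<open>Xs @ A # Ys\<close>. The induction hypothesis rearranges the tail into
  \<open>Xs @ Ys\<close>, and commuting two summands moves \<open>A\<close> past
  \<open>Xs\<close>.\<close>

lemma real_congruent_diag_block_mat_mset:
  assumes "mset As = mset Bs" "\<And>A. A \<in> set As \<Longrightarrow> dim_col A = dim_row A"
  shows "real_congruent (sum_list (map dim_row As)) (diag_block_mat As) (diag_block_mat Bs)"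
  using assms
proof (induction As arbitrary: Bs)
  case Nil
  then show ?case by (simp add: real_congruent_refl)
next
  case (Cons A As)
  have "A \<in> set Bs" using Cons.prems(1) by (metis list.set_intros(1) mset_eq_setD)
  then obtain Xs Ys where Bs: "Bs = Xs @ A # Ys" by (meson split_list)
  have ms: "mset As = mset (Xs @ Ys)" using Cons.prems(1) Bs by simp
  have set: "set As = set (Xs @ Ys)" using ms by (metis mset_eq_setD)
  let ?d = "\<lambda>As. sum_list (map dim_row As)"
  have car: "A \<in> carrier_mat (dim_row A) (dim_row A)"
    "diag_block_mat Xs \<in> carrier_mat (?d Xs) (?d Xs)" "diag_block_mat Ys \<in> carrier_mat (?d Ys) (?d Ys)"
    using Cons.prems(2) set by (auto intro!: carrier_matI diag_block_mat_carrier)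
  have dAs: "?d As = ?d Xs + ?d Ys"
    using arg_cong[OF ms, of "\<lambda>M. sum_mset (image_mset dim_row M)"]
    by (simp flip: sum_mset_sum_list)
  have "real_congruent (dim_row A + ?d As) (A \<oplus>\<^sub>d diag_block_mat As) (A \<oplus>\<^sub>d diag_block_mat (Xs @ Ys))"
    using Cons.prems(2) by (intro real_congruent_direct_sum real_congruent_refl car Cons.IH ms) auto
  moreover have "real_congruent (dim_row A + ?d Xs + ?d Ys)
     ((A \<oplus>\<^sub>d diag_block_mat Xs) \<oplus>\<^sub>d diag_block_mat Ys) ((diag_block_mat Xs \<oplus>\<^sub>d A) \<oplus>\<^sub>d diag_block_mat Ys)"
    by (intro real_congruent_direct_sum real_congruent_refl real_congruent_direct_sum_commute car)
  ultimately show ?case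
    unfolding Bs diag_block_mat_append_direct_sum diag_block_mat_Cons direct_sum_assoc list.map sum_list.Cons
    unfolding dAs add.assoc[symmetric] by (rule real_congruent_trans)
qed

subsection \<open>Accretive matrices and splitting off a block\<close>

text \<open>The test vectors are complex, to match the numerical range. For symmetric
  \<open>C\<close> with real part \<open>P\<close> and real \<open>Q\<close>, both
  \<open>x^H P x\<close> and \<open>x^H Q x\<close> are real, so the condition says that
  \<open>P\<close> is positive semidefinite.\<close>

definition accretive :: "nat \<Rightarrow> complex mat \<Rightarrow> bool" where
  "accretive n C \<longleftrightarrow> C \<in> carrier_mat n n \<and> (\<forall>x\<in>carrier_vec n. 0 \<le> Re ((C *\<^sub>v x) \<bullet>c x))"

lemma conjugate_real_mult_vec:
  assumes "S \<in> carrier_mat n m" "x \<in> carrier_vec m"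
  shows "conjugate (cmat S *\<^sub>v x) = cmat S *\<^sub>v conjugate x"
  by (rule eq_vecI) (use assms in \<open>auto simp: scalar_prod_def\<close>)

text \<open>Conjugation passes through the real matrix \<open>S\<close>, whence
  \<open>x^H B x = (S x)^H A (S x)\<close>.\<close>

lemma real_congruent_accretive:
  assumes "real_congruent n A B" "accretive n A"
  shows "accretive n B"
proof -
  from assms(1) obtain S where *: "A \<in> carrier_mat n n" "S \<in> carrier_mat n n"
    "B = cmat S\<^sup>T * A * cmat S"
    by (auto simp: real_congruent_def)
  have "(B *\<^sub>v x) \<bullet>c x = (A *\<^sub>v (cmat S *\<^sub>v x)) \<bullet>c (cmat S *\<^sub>v x)" if x: "x \<in> carrier_vec n" for x
  proof -
    have "(B *\<^sub>v x) \<bullet>c x = ((cmat S)\<^sup>T *\<^sub>v (A *\<^sub>v (cmat S *\<^sub>v x))) \<bullet> conjugate x"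
      unfolding *(3) using * x by (simp add: cmat_transpose assoc_mult_mat_vec[of _ n n _ n])
    also have "\<dots> = (A *\<^sub>v (cmat S *\<^sub>v x)) \<bullet> (cmat S *\<^sub>v conjugate x)"
      by (rule transpose_vec_mult_scalar) (use * x in auto)
    also have "\<dots> = (A *\<^sub>v (cmat S *\<^sub>v x)) \<bullet>c (cmat S *\<^sub>v x)"
      using conjugate_real_mult_vec[OF *(2) x] by simp
    finally show ?thesis .
  qed
  then show ?thesis
    using assms(2) * by (auto simp: accretive_def)
qed

lemma real_congruent_symmetric:
  assumes "real_congruent n A B" "A\<^sup>T = A"
  shows "B\<^sup>T = B"
proof -
  from assms(1) obtain S where *: "A \<in> carrier_mat n n" "S \<in> carrier_mat n n"
    "B = cmat S\<^sup>T * A * cmat S"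
    by (auto simp: real_congruent_def)
  show ?thesis
    unfolding *(3) using *
    by (simp add: cmat_transpose transpose_mult[of _ n n _ n] assoc_mult_mat[of _ n n _ n _ n] assms(2))
qed

text \<open>Cancels the split-off summand; this is how symmetry and realness descend to the
  complement on which a recursion continues.\<close>

lemma direct_sum_inj_right:
  assumes "A \<in> carrier_mat k k" "A' \<in> carrier_mat k k" "B \<in> carrier_mat l l" "B' \<in> carrier_mat l l"
    "A \<oplus>\<^sub>d B = A' \<oplus>\<^sub>d B'"
  shows "B = B'"
proof (rule eq_matI)
  fix i j assume "i < dim_row B'" "j < dim_col B'"
  then show "B $$ (i, j) = B' $$ (i, j)"
    using arg_cong[OF assms(5), of "\<lambda>M. M $$ (k + i, k + j)"] assms(1-4)
    by (simp add: direct_sum_def)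
qed (use assms in auto)

lemma direct_sum_symmetric:
  assumes "A \<in> carrier_mat k k" "B \<in> carrier_mat l l" "(A \<oplus>\<^sub>d B)\<^sup>T = A \<oplus>\<^sub>d B"
  shows "B\<^sup>T = B"
  using direct_sum_inj_right[of "A\<^sup>T" k A "B\<^sup>T" l B] assms by (simp add: direct_sum_transpose)

lemma conjugate_append_vec: "conjugate (x @\<^sub>v y) = conjugate x @\<^sub>v conjugate y"
  by (rule eq_vecI) auto

lemma direct_sum_quadratic_form:
  fixes A B :: "complex mat"
  assumes "A \<in> carrier_mat k k" "B \<in> carrier_mat l l" "x \<in> carrier_vec k" "y \<in> carrier_vec l"
  shows "((A \<oplus>\<^sub>d B) *\<^sub>v (x @\<^sub>v y)) \<bullet>c (x @\<^sub>v y) = (A *\<^sub>v x) \<bullet>c x + (B *\<^sub>v y) \<bullet>c y"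
  using assms
  by (simp add: direct_sum_mult_vec[of _ k _ l] conjugate_append_vec scalar_prod_append[of _ k _ l])

lemma accretive_direct_sum_iff:
  assumes "A \<in> carrier_mat k k" "B \<in> carrier_mat l l"
  shows "accretive (k + l) (A \<oplus>\<^sub>d B) \<longleftrightarrow> accretive k A \<and> accretive l B"
proof
  assume a: "accretive (k + l) (A \<oplus>\<^sub>d B)"
  have r: "0 \<le> Re ((A *\<^sub>v x) \<bullet>c x + (B *\<^sub>v y) \<bullet>c y)" if "x \<in> carrier_vec k" "y \<in> carrier_vec l" for x y
    using a that unfolding accretive_def direct_sum_quadratic_form[OF assms that, symmetric] by auto
  show "accretive k A \<and> accretive l B"
    using r[of _ "0\<^sub>v l"] r[of "0\<^sub>v k"] assms by (auto simp: accretive_def)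
next
  assume a: "accretive k A \<and> accretive l B"
  show "accretive (k + l) (A \<oplus>\<^sub>d B)"
    unfolding accretive_def
  proof (intro conjI ballI)
    fix z :: "complex vec" assume "z \<in> carrier_vec (k + l)"
    then obtain x y where z: "z = x @\<^sub>v y" and xy: "x \<in> carrier_vec k" "y \<in> carrier_vec l"
      by (metis vec_first_last_append vec_first_carrier vec_last_carrier)
    show "0 \<le> Re (((A \<oplus>\<^sub>d B) *\<^sub>v z) \<bullet>c z)"
      unfolding z direct_sum_quadratic_form[OF assms xy] using a xy by (auto simp: accretive_def)
  qed (use assms in auto)
qed

section \<open>Invertible matrices with prescribed columns\<close>

lemma ex_invertible_with_col:
  fixes v :: "'a :: field vec"
  assumes "v \<in> carrier_vec n" "v \<noteq> 0\<^sub>v n"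
  obtains S where "S \<in> carrier_mat n n" "det S \<noteq> 0" "col S 0 = v" "0 < n"
proof -
  interpret vec_space "TYPE('a)" n .
  let ?b = "basis_completion v"
  note b = basis_completion[OF assms]
  let ?S = "mat_of_cols n ?b"
  have S: "?S \<in> carrier_mat n n" using b(6) by (metis mat_of_cols_carrier(1))
  have c: "cols ?S = ?b" using b(2) by simp
  have "rank ?S = n" using lin_indpt_full_rank[OF S] b c by simp
  then have d: "det ?S \<noteq> 0" using det_rank_iff[OF S] by simp
  have n: "0 < n" using assms by (cases n) auto
  have "col ?S 0 = cols ?S ! 0" using S n b(6) by (metis carrier_matD(2) cols_nth)
  also have "\<dots> = v" unfolding c using b(6,7) n by (metis hd_conv_nth length_greater_0_conv)
  finally show ?thesis using that S d n by blast
qed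

text \<open>In the coordinates of a basis starting with \<open>v\<close>, the vector
  \<open>u\<close> becomes \<open>y\<close>. Its tail \<open>y'\<close> is nonzero because
  \<open>u\<close> is no multiple of \<open>v\<close>, so the tail can be completed to a basis of
  the remaining coordinates.\<close>

lemma ex_invertible_with_two_cols:
  fixes v u :: "'a :: field vec"
  assumes "v \<in> carrier_vec n" "v \<noteq> 0\<^sub>v n" "u \<in> carrier_vec n" "\<And>c. u \<noteq> c \<cdot>\<^sub>v v"
  obtains S where "S \<in> carrier_mat n n" "det S \<noteq> 0" "col S 0 = v" "col S 1 = u" "1 < n"
proof -
  obtain S where S: "S \<in> carrier_mat n n" "det S \<noteq> 0" "col S 0 = v" and n: "0 < n"
    using ex_invertible_with_col[OF assms(1,2)] .
  obtain R where R: "R \<in> carrier_mat n n" "S * R = 1\<^sub>m n" "R * S = 1\<^sub>m n"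
    using ex_inverse_mat[OF S(1,2)] .
  define m where "m = n - 1"
  have nm: "n = 1 + m" using n by (simp add: m_def)
  define y where "y = R *\<^sub>v u"
  have y: "y \<in> carrier_vec n" using R assms by (simp add: y_def)
  have Sy: "S *\<^sub>v y = u" unfolding y_def using R S assms
    by (simp flip: assoc_mult_mat_vec[of _ n n _ n])
  define y' where "y' = vec_last y m"
  have y': "y' \<in> carrier_vec m" by (simp add: y'_def)
  have yapp: "y = vec_first y 1 @\<^sub>v y'" using vec_first_last_append[of y 1 m] y nm by (simp add: y'_def)
  have Sv: "S *\<^sub>v unit_vec n 0 = v" using S n by (intro eq_vecI) auto
  have "y' \<noteq> 0\<^sub>v m"
  proof
    assume y0: "y' = 0\<^sub>v m"
    have "y = y $ 0 \<cdot>\<^sub>v unit_vec n 0"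
    proof (rule eq_vecI)
      fix i assume "i < dim_vec (y $ 0 \<cdot>\<^sub>v unit_vec n 0)"
      then have i: "i < n" by simp
      show "y $ i = (y $ 0 \<cdot>\<^sub>v unit_vec n 0) $ i"
      proof (cases "i = 0")
        case False
        have "y' $ (i - 1) = y $ i" using i False y nm by (cases i) (auto simp: y'_def vec_last_def)
        then show ?thesis using y0 i False nm by simp
      qed (use n in simp)
    qed (use y in auto)
    then have "u = S *\<^sub>v (y $ 0 \<cdot>\<^sub>v unit_vec n 0)" using Sy by simp
    also have "\<dots> = y $ 0 \<cdot>\<^sub>v v" using S Sv by (simp add: mult_mat_vec[of _ n n])
    finally show False using assms(4) by blast
  qed
  from ex_invertible_with_col[OF y' this] obtain Q where
    Q: "Q \<in> carrier_mat m m" "det Q \<noteq> 0" "col Q 0 = y'" and m0: "0 < m" .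
  \<comment> \<open>\<open>M\<close> has the columns \<open>unit_vec n 0\<close> and
    \<open>y\<close> in front. Of its upper right row only the leading entry is prescribed; a
    constant row provides it.\<close>
  define M where "M = four_block_mat (1\<^sub>m 1) (mat 1 m (\<lambda>_. y $ 0)) (0\<^sub>m m 1) Q"
  have M: "M \<in> carrier_mat n n" unfolding M_def nm using Q by (intro four_block_carrier_mat) auto
  have dM: "det M = det Q" unfolding M_def
    by (subst det_four_block_mat_lower_left_zero[of _ 1 _ m]) (use Q in auto)
  have M0: "col M 0 = unit_vec n 0"
    by (rule eq_vecI) (use M Q nm in \<open>auto simp: M_def\<close>)
  have M1: "col M 1 = y"
  proof (rule eq_vecI)
    fix i assume "i < dim_vec y"
    then have i: "i < 1 + m" using y nm by simp
    show "col M 1 $ i = y $ i"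
    proof (cases "i = 0")
      case True then show ?thesis using M nm m0 Q by (simp add: M_def)
    next
      case False
      have "col M 1 $ i = col Q 0 $ (i - 1)" using i False M nm m0 Q(1) by (simp add: M_def)
      also have "\<dots> = y $ i" unfolding Q(3) using i False y nm by (cases i) (auto simp: y'_def vec_last_def)
      finally show ?thesis .
    qed
  qed (use M y in auto)
  show ?thesis
  proof (rule that[of "S * M"])
    show "det (S * M) \<noteq> 0" using det_mult[OF S(1) M] S(2) Q(2) dM by simp
    show "col (S * M) 0 = v" using col_mult2[OF S(1) M] n M0 Sv by simp
    show "col (S * M) 1 = u" using col_mult2[OF S(1) M, of 1] nm m0 M1 Sy by simp
  qed (use S M nm m0 in auto)
qed

section \<open>Eliminating with a symmetric block\<close>

text \<open>Completing the square, with a given solution \<open>X\<close> of \<open>B = A X\<close>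
  in the place of \<open>A^-1 B\<close>. The block \<open>A\<close> may therefore be singular, as it
  is when a zero line is split off.\<close>

lemma schur_elimination:
  fixes A :: "complex mat"
  assumes A: "A \<in> carrier_mat k k" "A\<^sup>T = A" and X: "X \<in> carrier_mat k l" and D: "D \<in> carrier_mat l l"
    and BX: "B = A * cmat X"
  shows "real_congruent (k + l) (four_block_mat A B B\<^sup>T D) (A \<oplus>\<^sub>d (D - B\<^sup>T * cmat X))"
proof -
  have B: "B \<in> carrier_mat k l" using A X BX by auto
  define R where "R = four_block_mat (1\<^sub>m k) (- X) (0\<^sub>m l k) (1\<^sub>m l)"
  have R: "R \<in> carrier_mat (k + l) (k + l)" unfolding R_def using X by auto
  have dR: "det R = 1" unfolding R_def
    by (subst det_four_block_mat_lower_left_zero[of _ k _ l]) (use X in auto)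
  have c: "cmat R = four_block_mat (1\<^sub>m k) (- cmat X) (0\<^sub>m l k) (1\<^sub>m l)"
    unfolding R_def by (subst map_four_block_mat[of _ k k _ l _ l])
      (use X in \<open>auto simp: of_real_hom.mat_hom_one\<close>)
  have ct: "cmat R\<^sup>T = four_block_mat (1\<^sub>m k) (0\<^sub>m k l) (- (cmat X)\<^sup>T) (1\<^sub>m l)"
    unfolding cmat_transpose c
    by (subst transpose_four_block_mat[of _ k k _ l _ l])
      (use X in \<open>auto simp: transpose_uminus\<close>)
  have XB: "(cmat X)\<^sup>T * A = B\<^sup>T"
    unfolding BX using A X by (simp add: transpose_mult[of A k k _ l])
  \<comment> \<open>Both sides are \<open>X^T A X\<close>; this rewrites the lower right block
    \<open>D - X^T B\<close>.\<close>
  have e: "(cmat X)\<^sup>T * B = B\<^sup>T * cmat X"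
    unfolding BX XB[unfolded BX, symmetric] by (rule assoc_mult_mat[symmetric]) (use A X in auto)
  have Xc: "cmat X \<in> carrier_mat k l" "(cmat X)\<^sup>T \<in> carrier_mat l k" using X by auto
  have "cmat R\<^sup>T * four_block_mat A B B\<^sup>T D = four_block_mat A B (0\<^sub>m l k) (D - B\<^sup>T * cmat X)"
    unfolding ct
    by (subst mult_four_block_mat[of _ k k _ l _ l _ _ k _ l])
      (use A B D Xc in \<open>auto simp: XB e intro!: cong_four_block_mat eq_matI\<close>)
  moreover have "four_block_mat A B (0\<^sub>m l k) (D - B\<^sup>T * cmat X) * cmat R = A \<oplus>\<^sub>d (D - B\<^sup>T * cmat X)"
    unfolding c direct_sum_def
    by (subst mult_four_block_mat[of _ k k _ l _ l _ _ k _ l])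
      (use A B D Xc in \<open>auto simp: BX[symmetric] intro!: cong_four_block_mat eq_matI\<close>)
  ultimately show ?thesis
    using A B D R dR by (intro real_congruentI[of _ _ R]) auto
qed

text \<open>The first \<open>k\<close> columns of \<open>S\<close> span the summand to be split off. The coefficients \<open>X\<close> have to
  be real for the elimination to be a real congruence.\<close>

lemma split_off:
  assumes C: "C \<in> carrier_mat (k + l) (k + l)" "C\<^sup>T = C"
    and S: "S \<in> carrier_mat (k + l) (k + l)" "det S \<noteq> 0"
    and G: "G = cmat S\<^sup>T * C * cmat S"
    and A: "A = mat k k (\<lambda>ij. G $$ ij)"
    and X: "X \<in> carrier_mat k l"
    and AX: "\<And>i j. i < k \<Longrightarrow> j < l \<Longrightarrow> G $$ (i, k + j) = (A * cmat X) $$ (i, j)"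
  obtains C' where "C' \<in> carrier_mat l l" "real_congruent (k + l) C (A \<oplus>\<^sub>d C')"
proof -
  have CG: "real_congruent (k + l) C G" using C S G by (auto intro: real_congruentI)
  have Gc: "G \<in> carrier_mat (k + l) (k + l)" using real_congruent_carrier[OF CG] by simp
  have Gt: "G\<^sup>T = G" using real_congruent_symmetric[OF CG C(2)] .
  have sym: "G $$ (i, j) = G $$ (j, i)" if "i < k + l" "j < k + l" for i j
    using arg_cong[OF Gt, of "\<lambda>M. M $$ (i, j)"] that Gc by simp
  define D where "D = mat l l (\<lambda>(i, j). G $$ (k + i, k + j))"
  let ?B = "A * cmat X"
  have Ac: "A \<in> carrier_mat k k" "A\<^sup>T = A" using sym by (auto simp: A)
  have Dc: "D \<in> carrier_mat l l" by (simp add: D_def)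
  have Bc: "?B \<in> carrier_mat k l" using Ac X by simp
  have "G = four_block_mat A ?B ?B\<^sup>T D"
  proof (rule eq_matI)
    fix i j assume "i < dim_row (four_block_mat A ?B ?B\<^sup>T D)" "j < dim_col (four_block_mat A ?B ?B\<^sup>T D)"
    then have ij: "i < k + l" "j < k + l" using Ac Dc by auto
    show "G $$ (i, j) = four_block_mat A ?B ?B\<^sup>T D $$ (i, j)"
    proof (cases "i < k"; cases "j < k")
      assume "i < k" "j < k"
      then show ?thesis using Ac Dc ij by (simp add: A)
    next
      assume "i < k" "\<not> j < k"
      then show ?thesis using Ac Dc ij AX[of i "j - k"] X by simp
    next
      assume "\<not> i < k" "j < k"
      then show ?thesis using Ac Dc ij AX[of j "i - k"] X sym[of i j] by simp
    next
      assume "\<not> i < k" "\<not> j < k"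
      then show ?thesis using Ac Dc ij by (simp add: D_def)
    qed
  qed (use Ac Dc Gc in auto)
  then have "real_congruent (k + l) C (A \<oplus>\<^sub>d (D - ?B\<^sup>T * cmat X))"
    using schur_elimination[OF Ac X Dc refl] CG real_congruent_trans by metis
  then show ?thesis using that Dc Bc X by (metis minus_carrier_mat mult_carrier_mat transpose_carrier_mat map_carrier_mat)
qed

text \<open>The congruent matrix is the Gram matrix of the bilinear form of \<open>C\<close> on the
  columns of \<open>S\<close>, so knowing \<open>C\<close> on a leading column determines a whole
  row of it.\<close>

lemma gram_index:
  assumes "S \<in> carrier_mat n n" "C \<in> carrier_mat n n" "i < n" "j < n"
  shows "(cmat S\<^sup>T * C * cmat S) $$ (i, j) = cvec (col S i) \<bullet> (C *\<^sub>v cvec (col S j))"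
proof -
  have 1: "row (cmat S\<^sup>T) i = cvec (col S i)" "col (cmat S) j = cvec (col S j)"
    using assms by (auto intro!: eq_vecI)
  have "(cmat S\<^sup>T * C * cmat S) $$ (i, j) = (cmat S\<^sup>T * (C * cmat S)) $$ (i, j)"
    using assms by (simp add: assoc_mult_mat[of _ n n _ n _ n])
  also have "\<dots> = row (cmat S\<^sup>T) i \<bullet> col (C * cmat S) j"
    using assms by (subst index_mult_mat) auto
  also have "col (C * cmat S) j = C *\<^sub>v col (cmat S) j"
    using assms by (intro col_mult2[of _ n n _ n]) auto
  finally show ?thesis unfolding 1 .
qed

lemma symmetric_form_commute:
  fixes C :: "'a :: comm_semiring_1 mat"
  assumes "C \<in> carrier_mat n n" "C\<^sup>T = C" "x \<in> carrier_vec n" "y \<in> carrier_vec n"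
  shows "x \<bullet> (C *\<^sub>v y) = y \<bullet> (C *\<^sub>v x)"
proof -
  have "x \<bullet> (C *\<^sub>v y) = (C\<^sup>T *\<^sub>v x) \<bullet> y"
    using transpose_vec_mult_scalar[of C n n y x] assms by simp
  then show ?thesis using assms by (simp add: comm_scalar_prod[of _ n])
qed

lemma scalar_prod_cvec:
  "dim_vec y = dim_vec x \<Longrightarrow> cvec x \<bullet> cvec y = complex_of_real (x \<bullet> y)"
  by (simp add: scalar_prod_def)

text \<open>For nonzero \<open>a\<close> the vector \<open>f\<close> is \<open>C v / a\<close>, and
  its products with the other columns are the real elimination coefficients. For
  \<open>a = 0\<close> the hypothesis reads \<open>C v = 0\<close>, and any \<open>f\<close> will
  do.\<close>

lemma split_off_line:
  assumes C: "C \<in> carrier_mat (1 + l) (1 + l)" "C\<^sup>T = C"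
    and v: "v \<in> carrier_vec (1 + l)" "v \<noteq> 0\<^sub>v (1 + l)" and f: "f \<in> carrier_vec (1 + l)"
    and a: "a = cvec v \<bullet> (C *\<^sub>v cvec v)" and Cv: "C *\<^sub>v cvec v = a \<cdot>\<^sub>v cvec f"
  obtains C' where "C' \<in> carrier_mat l l" "real_congruent (1 + l) C (mat 1 1 (\<lambda>_. a) \<oplus>\<^sub>d C')"
proof -
  obtain S where S: "S \<in> carrier_mat (1 + l) (1 + l)" "det S \<noteq> 0" "col S 0 = v"
    using ex_invertible_with_col[OF v] by blast
  define G where "G = cmat S\<^sup>T * C * cmat S"
  define A where "A = mat 1 1 (\<lambda>ij. G $$ ij)"
  define X where "X = mat 1 l (\<lambda>(i, j). f \<bullet> col S (1 + j))"
  have G00: "G $$ (0, 0) = a" unfolding G_def by (subst gram_index[of _ "1 + l"]) (use S C a in auto)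
  have "G $$ (0, 1 + j) = (A * cmat X) $$ (0, j)" if j: "j < l" for j
  proof -
    have s: "col S (1 + j) \<in> carrier_vec (1 + l)" using carrier_matD(1)[OF S(1)] by (intro carrier_vecI) simp
    have "G $$ (0, 1 + j) = cvec v \<bullet> (C *\<^sub>v cvec (col S (1 + j)))"
      unfolding G_def using S C j by (subst gram_index[of _ "1 + l"]) auto
    also have "\<dots> = cvec (col S (1 + j)) \<bullet> (C *\<^sub>v cvec v)"
      by (rule symmetric_form_commute[OF C]) (use v s in auto)
    also have "\<dots> = a * complex_of_real (f \<bullet> col S (1 + j))"
      unfolding Cv using f s carrier_matD(1)[OF S(1)]
      by (simp add: scalar_prod_cvec comm_scalar_prod[of f "1 + l"])
    also have "\<dots> = (A * cmat X) $$ (0, j)"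
      using j G00 by (simp add: A_def X_def scalar_prod_def)
    finally show ?thesis .
  qed
  then obtain C' where "C' \<in> carrier_mat l l" "real_congruent (1 + l) C (A \<oplus>\<^sub>d C')"
    using split_off[OF C S(1,2) G_def A_def, of X] by (auto simp: X_def)
  moreover have "A = mat 1 1 (\<lambda>_. a)" using G00 by (auto simp: A_def)
  ultimately show ?thesis using that by simp
qed

section \<open>Diagonalizing the real part\<close>

abbreviation re_mat :: "complex mat \<Rightarrow> complex mat" where
  "re_mat \<equiv> map_mat (\<lambda>z. complex_of_real (Re z))"

text \<open>Taking real parts is linear over the reals. A congruence that diagonalizes the real part
  can thus be applied to \<open>C\<close> itself.\<close>

lemma re_mat_congruence:
  assumes "S \<in> carrier_mat n n" "C \<in> carrier_mat n n"
  shows "re_mat (cmat S\<^sup>T * C * cmat S) = cmat S\<^sup>T * re_mat C * cmat S"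
proof -
  have "re_mat (A * cmat S) = re_mat A * cmat S" if "A \<in> carrier_mat n n" for A
    by (rule eq_matI) (use that assms in \<open>simp_all add: scalar_prod_def\<close>)
  moreover have "re_mat (cmat S\<^sup>T * C) = cmat S\<^sup>T * re_mat C"
    by (rule eq_matI) (use assms in \<open>auto simp: scalar_prod_def\<close>)
  moreover have "cmat S\<^sup>T * C \<in> carrier_mat n n" using assms by simp
  ultimately show ?thesis by metis
qed

text \<open>Test vectors for polarization. The case \<open>i = j\<close> is included and gives twice
  a unit vector, so a symmetric form that vanishes on all these \<open>v\<close> is zero.\<close>

lemma unit_vec_add_form:
  fixes C :: "complex mat"
  assumes C: "C \<in> carrier_mat n n" and ij: "i < n" "j < n"
  defines "v \<equiv> unit_vec n i + unit_vec n j"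
  shows "v \<in> carrier_vec n" "v \<noteq> 0\<^sub>v n" "C *\<^sub>v cvec v = col C i + col C j"
    "cvec v \<bullet> (C *\<^sub>v cvec v) = C $$ (i, i) + C $$ (i, j) + C $$ (j, i) + C $$ (j, j)"
proof -
  show "v \<in> carrier_vec n" by (simp add: v_def)
  have "v $ i \<noteq> 0" using ij by (simp add: v_def)
  then show "v \<noteq> 0\<^sub>v n" using ij by auto
  have c: "cvec v = unit_vec n i + unit_vec n j" by (rule eq_vecI) (auto simp: v_def unit_vec_def)
  have u: "C *\<^sub>v unit_vec n k = col C k" if "k < n" for k
    using C that by (intro eq_vecI) auto
  show Cv: "C *\<^sub>v cvec v = col C i + col C j"
    unfolding c using C ij by (simp add: mult_add_distrib_mat_vec[of _ n n] u)
  show "cvec v \<bullet> (C *\<^sub>v cvec v) = C $$ (i, i) + C $$ (i, j) + C $$ (j, i) + C $$ (j, j)"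
    unfolding Cv unfolding c using C ij by (subst add_scalar_prod_distrib[of _ n]) (auto simp: algebra_simps)
qed

text \<open>Lagrange reduction: a form that is not yet diagonal is nonzero, so polarization yields a
  \<open>v\<close> with \<open>v^T C v\<close> nonzero, whose line splits off. No eigenvalues are
  involved.\<close>

lemma real_symmetric_diagonalizable:
  assumes "C \<in> carrier_mat n n" "C\<^sup>T = C" "re_mat C = C"
  shows "\<exists>D. real_congruent n C D \<and> diagonal_mat D"
  using assms
proof (induction n arbitrary: C)
  case 0
  then show ?case by (intro exI[of _ C]) (auto simp: real_congruent_refl diagonal_mat_def)
next
  case (Suc n)
  note C = Suc.prems(1,2)
  have re: "Im (C $$ (i, j)) = 0" if "i < Suc n" "j < Suc n" for i j
    using arg_cong[OF Suc.prems(3), of "\<lambda>M. Im (M $$ (i, j))"] that C by simp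
  have sym: "C $$ (i, j) = C $$ (j, i)" if "i < Suc n" "j < Suc n" for i j
    using that C by (metis carrier_matD index_transpose_mat(1))
  show ?case
  proof (cases "diagonal_mat C")
    case True
    then show ?thesis using C real_congruent_refl by blast
  next
    case False
    then obtain i0 j0 where ij0: "i0 < Suc n" "j0 < Suc n" "i0 \<noteq> j0" "C $$ (i0, j0) \<noteq> 0"
      using C by (auto simp: diagonal_mat_def)
    have "\<exists>i<Suc n. \<exists>j<Suc n. C $$ (i, i) + C $$ (i, j) + C $$ (j, i) + C $$ (j, j) \<noteq> 0"
    proof (rule ccontr)
      assume "\<not> ?thesis"
      then have z: "C $$ (i, i) + C $$ (i, j) + C $$ (j, i) + C $$ (j, j) = 0"
        if "i < Suc n" "j < Suc n" for i j using that by blast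
      \<comment> \<open>Setting \<open>i = j\<close> kills the diagonal; for the pair
        \<open>i0\<close>, \<open>j0\<close> the sum is then twice the nonzero entry.\<close>
      have "4 * C $$ (i, i) = 0" if "i < Suc n" for i using z[OF that that] by simp
      then show False using z[OF ij0(1,2)] sym[OF ij0(1,2)] ij0 by simp
    qed
    then obtain i j where ij: "i < Suc n" "j < Suc n" and
      nz: "C $$ (i, i) + C $$ (i, j) + C $$ (j, i) + C $$ (j, j) \<noteq> 0" by blast
    define v :: "real vec" where "v = unit_vec (Suc n) i + unit_vec (Suc n) j"
    note v = unit_vec_add_form[OF C(1) ij, folded v_def]
    define a where "a = cvec v \<bullet> (C *\<^sub>v cvec v)"
    have a: "a \<noteq> 0" "a = of_real (Re a)" using nz re ij by (auto simp: a_def v(4) complex_eq_iff)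
    define f where "f = vec (Suc n) (\<lambda>k. Re (C $$ (k, i) + C $$ (k, j)) / Re a)"
    have f: "f \<in> carrier_vec (Suc n)" by (simp add: f_def)
    have Cv: "C *\<^sub>v cvec v = a \<cdot>\<^sub>v cvec f"
    proof (rule eq_vecI)
      fix k assume "k < dim_vec (a \<cdot>\<^sub>v cvec f)"
      then have k: "k < Suc n" by (simp add: f_def)
      have "C $$ (k, i) + C $$ (k, j) = of_real (Re a) * of_real (Re (C $$ (k, i) + C $$ (k, j)) / Re a)"
        using re k ij a by (auto simp: complex_eq_iff)
      then show "(C *\<^sub>v cvec v) $ k = (a \<cdot>\<^sub>v cvec f) $ k"
        unfolding v(3) using k ij C a(2) by (simp add: f_def)
    qed (use C in \<open>auto simp: f_def\<close>)
    obtain C' where C': "C' \<in> carrier_mat n n" "real_congruent (Suc n) C (mat 1 1 (\<lambda>_. a) \<oplus>\<^sub>d C')"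
      using split_off_line[of C n v f a, unfolded plus_1_eq_Suc, OF C v(1,2) f a_def Cv] by blast
    have "(mat 1 1 (\<lambda>_. a) \<oplus>\<^sub>d C')\<^sup>T = mat 1 1 (\<lambda>_. a) \<oplus>\<^sub>d C'"
      using real_congruent_symmetric[OF C'(2) C(2)] .
    then have sym': "C'\<^sup>T = C'" using direct_sum_symmetric[of "mat 1 1 (\<lambda>_. a)" 1] C' by simp
    have "re_mat (mat 1 1 (\<lambda>_. a) \<oplus>\<^sub>d C') = mat 1 1 (\<lambda>_. a) \<oplus>\<^sub>d C'"
    proof -
      obtain S where "S \<in> carrier_mat (Suc n) (Suc n)"
        and S: "mat 1 1 (\<lambda>_. a) \<oplus>\<^sub>d C' = cmat S\<^sup>T * C * cmat S"
        using C'(2) by (auto simp: real_congruent_def)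
      then show ?thesis
        unfolding S using re_mat_congruence[of S "Suc n" C] Suc.prems(3) C(1) by simp
    qed
    then have "re_mat C' = C'"
      using direct_sum_inj_right[of "re_mat (mat 1 1 (\<lambda>_. a))" 1 "mat 1 1 (\<lambda>_. a)" "re_mat C'" n C'] C'
      by (simp add: direct_sum_map)
    from Suc.IH[OF C'(1) sym' this] obtain D where D: "real_congruent n C' D" "diagonal_mat D" by blast
    have "real_congruent (1 + n) (mat 1 1 (\<lambda>_. a) \<oplus>\<^sub>d C') (mat 1 1 (\<lambda>_. a) \<oplus>\<^sub>d D)"
      by (intro real_congruent_direct_sum real_congruent_refl D) simp
    then have "real_congruent (Suc n) C (mat 1 1 (\<lambda>_. a) \<oplus>\<^sub>d D)"
      using C'(2) real_congruent_trans by (metis plus_1_eq_Suc)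
    moreover have "diagonal_mat (mat 1 1 (\<lambda>_. a) \<oplus>\<^sub>d D)"
      using D(2) real_congruent_carrier[OF D(1)] by (auto simp: diagonal_mat_def direct_sum_def)
    ultimately show ?thesis by blast
  qed
qed

lemma ex_congruent_diagonal_real_part:
  assumes "C \<in> carrier_mat n n" "C\<^sup>T = C"
  obtains D where "real_congruent n C D" "\<And>i j. i < n \<Longrightarrow> j < n \<Longrightarrow> i \<noteq> j \<Longrightarrow> Re (D $$ (i, j)) = 0"
proof -
  have "(re_mat C)\<^sup>T = re_mat C" using assms(2) by (metis map_mat_transpose)
  moreover have "re_mat (re_mat C) = re_mat C" by auto
  ultimately obtain D where D: "real_congruent n (re_mat C) D" "diagonal_mat D"
    using real_symmetric_diagonalizable[of "re_mat C" n] assms by auto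
  then obtain S where S: "S \<in> carrier_mat n n" "det S \<noteq> 0" "D = cmat S\<^sup>T * re_mat C * cmat S"
    by (auto simp: real_congruent_def)
  show ?thesis
  proof (rule that[of "cmat S\<^sup>T * C * cmat S"])
    show "real_congruent n C (cmat S\<^sup>T * C * cmat S)" using assms S by (auto intro: real_congruentI)
  next
    fix i j assume ij: "i < n" "j < n" "i \<noteq> j"
    have "complex_of_real (Re ((cmat S\<^sup>T * C * cmat S) $$ (i, j))) = re_mat (cmat S\<^sup>T * C * cmat S) $$ (i, j)"
      using S assms ij by (subst index_map_mat) auto
    also have "\<dots> = D $$ (i, j)" unfolding S(3) re_mat_congruence[OF S(1) assms(1)] ..
    also have "\<dots> = 0" using D ij real_congruent_carrier[OF D(1)] by (auto simp: diagonal_mat_def)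
    finally show "Re ((cmat S\<^sup>T * C * cmat S) $$ (i, j)) = 0" by simp
  qed
qed

text \<open>A complex eigenvector of \<open>D^-1 Q\<close> exists, with \<open>D\<close> the
  diagonal matrix of the \<open>d i\<close>. Its eigenvalue is a Rayleigh quotient and hence real,
  so the equation splits into real and imaginary parts.\<close>

lemma ex_real_generalized_eigenvector:
  fixes Q :: "nat \<Rightarrow> nat \<Rightarrow> real"
  assumes "0 < n" and sym: "\<And>i j. i < n \<Longrightarrow> j < n \<Longrightarrow> Q i j = Q j i" and d: "\<And>i. i < n \<Longrightarrow> 0 < d i"
  obtains r y where "y \<in> carrier_vec n" "y \<noteq> 0\<^sub>v n"
    "\<And>i. i < n \<Longrightarrow> (\<Sum>j<n. Q i j * y $ j) = r * d i * y $ i"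
proof -
  define M where "M = mat n n (\<lambda>(i, j). complex_of_real (Q i j / d i))"
  have M: "M \<in> carrier_mat n n" by (simp add: M_def)
  obtain z x where x: "x \<in> carrier_vec n" "x \<noteq> 0\<^sub>v n" "M *\<^sub>v x = z \<cdot>\<^sub>v x"
    using spectrum_non_empty[OF M assms(1)] M by (auto simp: spectrum_def eigenvalue_def eigenvector_def)
  have ev: "(\<Sum>j<n. of_real (Q i j) * x $ j) = z * of_real (d i) * x $ i" if i: "i < n" for i
  proof -
    have "(\<Sum>j<n. of_real (Q i j / d i) * x $ j) = z * x $ i"
      using arg_cong[OF x(3), of "\<lambda>u. u $ i"] i x(1)
      by (simp add: M_def scalar_prod_def atLeast0LessThan)
    moreover have "(\<Sum>j<n. of_real (Q i j) * x $ j) = of_real (d i) * (\<Sum>j<n. of_real (Q i j / d i) * x $ j)"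
      unfolding sum_distrib_left using d[OF i] by (intro sum.cong) auto
    ultimately show ?thesis by (simp only: mult_ac)
  qed
  \<comment> \<open>\<open>q = x^H Q x\<close> is real by symmetry of \<open>Q\<close>,
    \<open>p = x^H D x\<close> is positive, and \<open>q = z p\<close>.\<close>
  define q where "q = (\<Sum>i<n. \<Sum>j<n. cnj (x $ i) * of_real (Q i j) * x $ j)"
  define p where "p = (\<Sum>i<n. d i * (cmod (x $ i))\<^sup>2)"
  have "cnj q = (\<Sum>i<n. \<Sum>j<n. cnj (x $ j) * of_real (Q i j) * x $ i)"
    by (simp add: q_def cnj_sum mult_ac)
  also have "\<dots> = (\<Sum>j<n. \<Sum>i<n. cnj (x $ j) * of_real (Q i j) * x $ i)" by (rule sum.swap)
  also have "\<dots> = q" unfolding q_def by (intro sum.cong refl) (auto simp: sym)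
  finally have "Im q = 0" by (metis complex_cnj Reals_cnj_iff complex_is_Real_iff)
  moreover have "q = (\<Sum>i<n. cnj (x $ i) * (z * of_real (d i) * x $ i))"
    unfolding q_def
    by (intro sum.cong refl, subst ev[symmetric]) (simp_all add: sum_distrib_left mult.assoc)
  then have "q = z * of_real p"
    unfolding p_def of_real_sum of_real_mult complex_norm_square by (simp add: sum_distrib_left mult_ac)
  moreover have "0 < p"
  proof -
    obtain i where i: "i < n" "x $ i \<noteq> 0" using x(1,2) by (metis carrier_vecD eq_vecI index_zero_vec(1,2))
    have "0 < d i * (cmod (x $ i))\<^sup>2" using d i by simp
    also have "\<dots> \<le> p" unfolding p_def using d i by (intro member_le_sum) (auto simp: less_imp_le)
    finally show ?thesis .
  qed
  ultimately have "Im z = 0" by simp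
  then have z: "z = of_real (Re z)" by (simp add: complex_eq_iff)
  have re: "(\<Sum>j<n. Q i j * Re (x $ j)) = Re z * d i * Re (x $ i)" if "i < n" for i
    using arg_cong[OF ev[OF that], of Re] \<open>Im z = 0\<close> by simp
  have im: "(\<Sum>j<n. Q i j * Im (x $ j)) = Re z * d i * Im (x $ i)" if "i < n" for i
    using arg_cong[OF ev[OF that], of Im] \<open>Im z = 0\<close> by simp
  \<comment> \<open>Both parts of \<open>x\<close> satisfy the real equation, and since
    \<open>x\<close> is nonzero one of them is nonzero.\<close>
  show ?thesis
  proof (cases "map_vec Re x = 0\<^sub>v n")
    case False
    then show ?thesis using x(1) re by (intro that[of "map_vec Re x" "Re z"]) auto
  next
    case True
    have "map_vec Im x \<noteq> 0\<^sub>v n"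
    proof
      assume im0: "map_vec Im x = 0\<^sub>v n"
      have "x $ i = 0" if "i < n" for i
        using arg_cong[OF True, of "\<lambda>u. u $ i"] arg_cong[OF im0, of "\<lambda>u. u $ i"] that x(1)
        by (simp add: complex_eq_iff)
      then have "x = 0\<^sub>v n" using x(1) by (intro eq_vecI) auto
      then show False using x(2) by simp
    qed
    then show ?thesis using x(1) im by (intro that[of "map_vec Im x" "Re z"]) auto
  qed
qed

subsection \<open>Normalizing the blocks that split off\<close>

definition E_cell :: "complex mat" where
  "E_cell = mat_of_rows_list 2 [[0, - \<i>], [- \<i>, 1]]"

lemma E_cell_carrier [simp]: "E_cell \<in> carrier_mat 2 2"
  unfolding E_cell_def mat_of_rows_list_def by (rule carrier_matI) simp_all

lemma E_cell_index [simp]: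
  "E_cell $$ (0, 0) = 0" "E_cell $$ (0, Suc 0) = - \<i>" "E_cell $$ (Suc 0, 0) = - \<i>"
  "E_cell $$ (Suc 0, Suc 0) = 1"
  by (simp_all add: E_cell_def mat_of_rows_list_def)

definition phase_mat :: "real \<Rightarrow> complex mat" where
  "phase_mat t = mat 1 1 (\<lambda>_. cis t)"

text \<open>These are the summands before the rotation by \<open>cis \<theta>\<close> is undone,
  which is why the angles are centred at 0.\<close>

definition canonical_block :: "complex mat \<Rightarrow> bool" where
  "canonical_block B \<longleftrightarrow>
     B = 0\<^sub>m 1 1 \<or> (\<exists>t. \<bar>t\<bar> \<le> pi / 2 \<and> B = phase_mat t) \<or> B = E_cell"

text \<open>A real scaling enters a congruence twice, so \<open>1 / sqrt (cmod a)\<close> removes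
  exactly the modulus of \<open>a\<close>. The remaining phase has nonnegative cosine.\<close>

lemma normalize_line:
  assumes "0 \<le> Re a"
  obtains B where "canonical_block B" "real_congruent 1 (mat 1 1 (\<lambda>_. a)) B"
proof (cases "a = 0")
  case True
  then have "mat 1 1 (\<lambda>_. a) = 0\<^sub>m 1 1" by auto
  then show ?thesis using that[of "0\<^sub>m 1 1"] by (simp add: canonical_block_def real_congruent_refl)
next
  case False
  have "cos (Arg a) \<ge> 0" using assms False by (simp add: cos_Arg)
  have "\<bar>Arg a\<bar> \<le> pi / 2"
  proof (rule ccontr)
    assume "\<not> ?thesis"
    then have "cos \<bar>Arg a\<bar> < cos (pi / 2)"
      using Arg_bounded[of a] by (intro cos_monotone_0_pi) auto
    then show False using \<open>cos (Arg a) \<ge> 0\<close> by simp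
  qed
  moreover have "real_congruent 1 (mat 1 1 (\<lambda>_. a)) (phase_mat (Arg a))"
  proof (rule real_congruentI[of _ _ "mat 1 1 (\<lambda>_. 1 / sqrt (cmod a))"])
    have "cis (Arg a) = of_real (1 / sqrt (cmod a)) * a * of_real (1 / sqrt (cmod a))"
      using False by (simp add: cis_Arg sgn_eq flip: of_real_mult)
    then show "phase_mat (Arg a) = cmat (mat 1 1 (\<lambda>_. 1 / sqrt (cmod a)))\<^sup>T * mat 1 1 (\<lambda>_. a) *
        cmat (mat 1 1 (\<lambda>_. 1 / sqrt (cmod a)))"
      by (auto simp: phase_mat_def scalar_prod_def)
  qed (use False in \<open>auto simp: det_single\<close>)
  ultimately show ?thesis using that canonical_block_def by blast
qed

lemma canonical_line:
  assumes C: "C \<in> carrier_mat (1 + l) (1 + l)" "C\<^sup>T = C" "accretive (1 + l) C"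
    and v: "v \<in> carrier_vec (1 + l)" "v \<noteq> 0\<^sub>v (1 + l)" and f: "f \<in> carrier_vec (1 + l)"
    and a: "a = cvec v \<bullet> (C *\<^sub>v cvec v)" and Cv: "C *\<^sub>v cvec v = a \<cdot>\<^sub>v cvec f"
  obtains B C' where "canonical_block B" "B \<in> carrier_mat 1 1" "C' \<in> carrier_mat l l"
    "real_congruent (1 + l) C (B \<oplus>\<^sub>d C')"
proof -
  obtain C' where C': "C' \<in> carrier_mat l l" "real_congruent (1 + l) C (mat 1 1 (\<lambda>_. a) \<oplus>\<^sub>d C')"
    using split_off_line[OF C(1,2) v f a Cv] .
  have "accretive 1 (mat 1 1 (\<lambda>_. a))"
    using real_congruent_accretive[OF C'(2) C(3)] C'(1) by (subst (asm) accretive_direct_sum_iff) auto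
  then have "0 \<le> Re ((mat 1 1 (\<lambda>_. a) *\<^sub>v vec 1 (\<lambda>_. 1)) \<bullet>c vec 1 (\<lambda>_. 1))"
    unfolding accretive_def by auto
  then have "0 \<le> Re a" by (simp add: scalar_prod_def)
  then obtain B where B: "canonical_block B" "real_congruent 1 (mat 1 1 (\<lambda>_. a)) B"
    using normalize_line by blast
  have "real_congruent (1 + l) (mat 1 1 (\<lambda>_. a) \<oplus>\<^sub>d C') (B \<oplus>\<^sub>d C')"
    using B C' by (intro real_congruent_direct_sum real_congruent_refl)
  then show ?thesis
    using that B C' real_congruent_trans real_congruent_carrier by blast
qed

text \<open>With \<open>C = P + iQ\<close> the hypotheses say \<open>P v = 0\<close>,
  \<open>Q v = b\<close>, \<open>P u = - b\<close> and \<open>Q u = q\<close>. The same vector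
  \<open>b\<close> appears in \<open>C v\<close> and \<open>C u\<close>, and this makes the
  elimination coefficients real.\<close>

lemma canonical_pair:
  assumes C: "C \<in> carrier_mat (2 + l) (2 + l)" "C\<^sup>T = C"
    and car: "v \<in> carrier_vec (2 + l)" "u \<in> carrier_vec (2 + l)" "b \<in> carrier_vec (2 + l)" "q \<in> carrier_vec (2 + l)"
    and Cv: "C *\<^sub>v cvec v = \<i> \<cdot>\<^sub>v cvec b" and Cu: "C *\<^sub>v cvec u = - cvec b + \<i> \<cdot>\<^sub>v cvec q"
    and bv: "b \<bullet> v = 0" and bu: "b \<bullet> u = -1" and qu: "q \<bullet> u = 0"
  obtains C' where "C' \<in> carrier_mat l l" "real_congruent (2 + l) C (E_cell \<oplus>\<^sub>d C')"
proof -
  have v0: "v \<noteq> 0\<^sub>v (2 + l)"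
  proof
    assume "v = 0\<^sub>v (2 + l)"
    then have "C *\<^sub>v cvec v = 0\<^sub>v (2 + l)" using C by (auto intro!: eq_vecI simp: scalar_prod_def)
    then have b0: "\<i> \<cdot>\<^sub>v cvec b = 0\<^sub>v (2 + l)" using Cv by simp
    have "b $ i = 0" if "i < 2 + l" for i
      using arg_cong[OF b0, of "\<lambda>x. x $ i"] that car by simp
    then have "b = 0\<^sub>v (2 + l)" using car by (intro eq_vecI) auto
    then show False using bu car by simp
  qed
  \<comment> \<open>The functional \<open>b\<close> vanishes on \<open>v\<close> but not on
    \<open>u\<close>.\<close>
  have indep: "u \<noteq> c \<cdot>\<^sub>v v" for c using bv bu car by auto
  obtain S where S: "S \<in> carrier_mat (2 + l) (2 + l)" "det S \<noteq> 0" "col S 0 = v" "col S 1 = u"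
    using ex_invertible_with_two_cols[OF car(1) v0 car(2) indep] by blast
  define G where "G = cmat S\<^sup>T * C * cmat S"
  define A where "A = mat 2 2 (\<lambda>ij. G $$ ij)"
  \<comment> \<open>Solves \<open>E_cell * X = G12\<close> for the column belonging to
    \<open>s\<close>, where \<open>G12\<close> has the entries \<open>i (b . s)\<close> and
    \<open>- (b . s) + i (q . s)\<close>: the upper row forces the lower coefficient
    \<open>- (b . s)\<close>, and the lower row leaves \<open>- (q . s)\<close> for the upper
    one.\<close>
  define X where "X = mat 2 l (\<lambda>(i, j). - ((if i = 0 then q else b) \<bullet> col S (2 + j)))"
  have Cvw: "cvec v \<bullet> (C *\<^sub>v cvec w) = \<i> * of_real (b \<bullet> w)"
    and Cuw: "cvec u \<bullet> (C *\<^sub>v cvec w) = - of_real (b \<bullet> w) + \<i> * of_real (q \<bullet> w)"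
    if w: "w \<in> carrier_vec (2 + l)" for w
  proof -
    have "cvec v \<bullet> (C *\<^sub>v cvec w) = cvec w \<bullet> (C *\<^sub>v cvec v)"
      by (rule symmetric_form_commute[OF C]) (use car w in auto)
    then show "cvec v \<bullet> (C *\<^sub>v cvec w) = \<i> * of_real (b \<bullet> w)"
      unfolding Cv using car w by (simp add: scalar_prod_cvec comm_scalar_prod[of b "2 + l"])
    have "cvec u \<bullet> (C *\<^sub>v cvec w) = cvec w \<bullet> (C *\<^sub>v cvec u)"
      by (rule symmetric_form_commute[OF C]) (use car w in auto)
    then show "cvec u \<bullet> (C *\<^sub>v cvec w) = - of_real (b \<bullet> w) + \<i> * of_real (q \<bullet> w)"
      unfolding Cu using car w
      by (simp add: scalar_prod_cvec comm_scalar_prod[of _ "2 + l"] scalar_prod_add_distrib[of _ "2 + l"])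
  qed
  have G: "G $$ (i, j) = cvec (col S i) \<bullet> (C *\<^sub>v cvec (col S j))" if "i < 2 + l" "j < 2 + l" for i j
    unfolding G_def using gram_index[OF S(1) C(1) that] .
  \<comment> \<open>Symmetry of \<open>Q\<close>: \<open>q . v = u^T Q v = b . u\<close>.\<close>
  have uv: "q \<bullet> v = -1"
    using Cuw[OF car(1)] Cvw[OF car(2)] symmetric_form_commute[OF C, of "cvec u" "cvec v"] car bv bu
    by (simp add: complex_eq_iff)
  have G4: "G $$ (0, 0) = 0" "G $$ (0, 1) = - \<i>" "G $$ (1, 0) = - \<i>" "G $$ (1, 1) = 1"
    using G[of 0 0] G[of 0 1] G[of 1 0] G[of 1 1] Cvw[OF car(1)] Cvw[OF car(2)] Cuw[OF car(1)] Cuw[OF car(2)]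
    unfolding S(3,4) by (simp_all add: bv bu qu uv)
  have AE: "A = E_cell"
    using G4 by (intro eq_matI) (auto simp: A_def less_2_cases_iff carrier_matD[OF E_cell_carrier])
  have "G $$ (i, 2 + j) = (A * cmat X) $$ (i, j)" if ij: "i < 2" "j < l" for i j
  proof -
    have s: "col S (2 + j) \<in> carrier_vec (2 + l)"
      using carrier_matD(1)[OF S(1)] by (intro carrier_vecI) simp
    have "G $$ (i, 2 + j) = cvec (col S i) \<bullet> (C *\<^sub>v cvec (col S (2 + j)))" using ij by (intro G) auto
    moreover have "i = 0 \<or> i = 1" using ij by auto
    ultimately show ?thesis
      unfolding AE using ij S(3,4) Cvw[OF s] Cuw[OF s]
      by (auto simp: X_def scalar_prod_def row_def carrier_matD[OF E_cell_carrier] algebra_simps numeral_2_eq_2)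
  qed
  then obtain C' where "C' \<in> carrier_mat l l" "real_congruent (2 + l) C (A \<oplus>\<^sub>d C')"
    using split_off[OF C S(1,2) G_def A_def, of X] by (auto simp: X_def)
  then show ?thesis using that AE by blast
qed

subsection \<open>Reduction to a block diagonal matrix\<close>

text \<open>As \<open>P v = 0\<close>, adding a multiple of \<open>v\<close> to \<open>w\<close>
  changes \<open>Q w\<close> but not \<open>P w = b\<close>. This freedom removes the imaginary part
  of the form on the second vector, and scaling does the rest.\<close>

lemma canonical_step_pair:
  assumes C: "C \<in> carrier_mat n n" "C\<^sup>T = C"
    and car: "v \<in> carrier_vec n" "w \<in> carrier_vec n" "b \<in> carrier_vec n" "q \<in> carrier_vec n"
    and Cv: "C *\<^sub>v cvec v = \<i> \<cdot>\<^sub>v cvec b" and Cw: "C *\<^sub>v cvec w = cvec b + \<i> \<cdot>\<^sub>v cvec q"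
    and bv: "b \<bullet> v = 0" and bw: "0 < b \<bullet> w" and n: "n = 2 + l"
  obtains C' where "C' \<in> carrier_mat l l" "real_congruent n C (E_cell \<oplus>\<^sub>d C')"
proof -
  define a where "a = b \<bullet> w"
  \<comment> \<open>With \<open>u' = w + c v\<close> the imaginary part of \<open>u'^T C u'\<close>
    is \<open>q . w + 2 c a\<close>, because \<open>q . v = a\<close>; \<open>c\<close> is its
    root.\<close>
  define c where "c = - (q \<bullet> w) / (2 * a)"
  define s where "s = 1 / sqrt a"
  have a: "0 < a" using bw by (simp add: a_def)
  have s2: "s * s * a = 1" using a by (simp add: s_def)
  have cw: "cvec v \<in> carrier_vec n" "cvec w \<in> carrier_vec n" using car by auto
  have "cvec v \<bullet> (C *\<^sub>v cvec w) = cvec w \<bullet> (C *\<^sub>v cvec v)"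
    by (rule symmetric_form_commute[OF C cw])
  then have "Im (cvec v \<bullet> (cvec b + \<i> \<cdot>\<^sub>v cvec q)) = Im (cvec w \<bullet> (\<i> \<cdot>\<^sub>v cvec b))"
    unfolding Cv Cw by simp
  then have "v \<bullet> q = w \<bullet> b"
    using car by (simp add: scalar_prod_add_distrib[of _ n] scalar_prod_cvec)
  then have qv: "q \<bullet> v = a" using car by (simp add: a_def comm_scalar_prod[of _ n])
  define u' where "u' = w + c \<cdot>\<^sub>v v"
  define q' where "q' = q + c \<cdot>\<^sub>v b"
  have u': "u' \<in> carrier_vec n" and q': "q' \<in> carrier_vec n" using car by (auto simp: u'_def q'_def)
  have bu': "b \<bullet> u' = a" unfolding u'_def using car by (simp add: scalar_prod_add_distrib[of _ n] bv a_def)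
  have "q \<bullet> u' = q \<bullet> w + c * a" unfolding u'_def using car by (simp add: scalar_prod_add_distrib[of _ n] qv)
  then have "q' \<bullet> u' = q \<bullet> w + 2 * (c * a)"
    unfolding q'_def using car u' by (simp add: add_scalar_prod_distrib[of _ n] bu')
  then have qu': "q' \<bullet> u' = 0" using a by (simp add: c_def)
  have cs: "cvec (r \<cdot>\<^sub>v x) = of_real r \<cdot>\<^sub>v cvec x" for r x by (rule eq_vecI) auto
  have cu': "cvec u' = cvec w + of_real c \<cdot>\<^sub>v cvec v"
    using car by (intro eq_vecI) (auto simp: u'_def)
  have "C *\<^sub>v cvec u' = C *\<^sub>v cvec w + of_real c \<cdot>\<^sub>v (C *\<^sub>v cvec v)"
    unfolding cu' using C car by (simp add: mult_add_distrib_mat_vec[of _ n n] mult_mat_vec[of _ n n])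
  then have Cu': "C *\<^sub>v cvec u' = cvec b + \<i> \<cdot>\<^sub>v cvec q'"
    unfolding Cv Cw using car by (intro eq_vecI) (auto simp: q'_def algebra_simps)
  show ?thesis
  \<comment> \<open>The factor \<open>s\<close> normalizes \<open>b . w\<close> to 1. The sign
    change of \<open>v\<close> produces the entries \<open>- \<i>\<close> of the cell instead of
    \<open>\<i>\<close>.\<close>
  proof (rule canonical_pair[of C l "(- s) \<cdot>\<^sub>v v" "s \<cdot>\<^sub>v u'" "(- s) \<cdot>\<^sub>v b" "s \<cdot>\<^sub>v q'"])
    show "C *\<^sub>v cvec ((- s) \<cdot>\<^sub>v v) = \<i> \<cdot>\<^sub>v cvec ((- s) \<cdot>\<^sub>v b)"
      unfolding cs using C car by (subst mult_mat_vec[of _ n n]) (auto simp: Cv smult_smult_assoc mult.commute)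
    show "C *\<^sub>v cvec (s \<cdot>\<^sub>v u') = - cvec ((- s) \<cdot>\<^sub>v b) + \<i> \<cdot>\<^sub>v cvec (s \<cdot>\<^sub>v q')"
      unfolding cs using C u' q' car
      by (subst mult_mat_vec[of _ n n]) (auto simp: Cu' algebra_simps intro!: eq_vecI)
    show "((- s) \<cdot>\<^sub>v b) \<bullet> ((- s) \<cdot>\<^sub>v v) = 0" using car bv by simp
    show "((- s) \<cdot>\<^sub>v b) \<bullet> (s \<cdot>\<^sub>v u') = - 1" using car u' bu' s2 by (simp add: mult.assoc)
    show "(s \<cdot>\<^sub>v q') \<bullet> (s \<cdot>\<^sub>v u') = 0" using q' u' qu' by simp
  qed (use C car u' q' that in \<open>auto simp: n\<close>)
qed

text \<open>With \<open>d\<close> the diagonal of \<open>P\<close>, the kernel of \<open>P\<close>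
  is spanned by the unit vectors at the zeros of \<open>d\<close>. The cases are whether
  \<open>Q\<close> has a nonzero entry between two zeros of \<open>d\<close>, and otherwise whether
  \<open>d\<close> has a zero at all.\<close>

lemma canonical_step_diagonal:
  assumes C: "C \<in> carrier_mat n n" "C\<^sup>T = C" "accretive n C" and n: "0 < n"
    and diag: "\<And>i j. i < n \<Longrightarrow> j < n \<Longrightarrow> i \<noteq> j \<Longrightarrow> Re (C $$ (i, j)) = 0"
  obtains k l B C' where "n = k + l" "0 < k" "canonical_block B" "B \<in> carrier_mat k k"
    "C' \<in> carrier_mat l l" "real_congruent n C (B \<oplus>\<^sub>d C')"
proof -
  note split_found = that
  define d where "d i = Re (C $$ (i, i))" for i
  define Q where "Q i j = Im (C $$ (i, j))" for i j
  have sym: "C $$ (i, j) = C $$ (j, i)" if "i < n" "j < n" for i j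
    using that C by (metis carrier_matD index_transpose_mat(1))
  have Qsym: "Q i j = Q j i" if "i < n" "j < n" for i j using sym[OF that] by (simp add: Q_def)
  have Cij: "C $$ (i, j) = of_real (if i = j then d i else 0) + \<i> * of_real (Q i j)" if "i < n" "j < n" for i j
    using diag that by (auto simp: complex_eq_iff d_def Q_def)
  have Cx: "(C *\<^sub>v cvec x) $ i = of_real (d i * x $ i) + \<i> * of_real (\<Sum>j<n. Q i j * x $ j)"
    if "i < n" "x \<in> carrier_vec n" for i x
  proof -
    have "(C *\<^sub>v cvec x) $ i = (\<Sum>j<n. C $$ (i, j) * of_real (x $ j))"
      using C that by (simp add: scalar_prod_def atLeast0LessThan)
    also have "\<dots> = (\<Sum>j<n. of_real (if i = j then d i * x $ j else 0) + \<i> * of_real (Q i j * x $ j))"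
      using that by (intro sum.cong refl) (auto simp: Cij algebra_simps)
    also have "\<dots> = of_real (\<Sum>j<n. if i = j then d i * x $ j else 0) + \<i> * of_real (\<Sum>j<n. Q i j * x $ j)"
      by (simp only: sum.distrib of_real_sum sum_distrib_left)
    also have "(\<Sum>j<n. if i = j then d i * x $ j else 0) = d i * x $ i"
      using that by (simp add: sum.delta')
    finally show ?thesis .
  qed
  have line: thesis if v: "v \<in> carrier_vec n" "v \<noteq> 0\<^sub>v n" and f: "f \<in> carrier_vec n"
    and Cv: "C *\<^sub>v cvec v = (cvec v \<bullet> (C *\<^sub>v cvec v)) \<cdot>\<^sub>v cvec f" for v f
  proof -
    define l where "l = n - 1"
    have nl: "n = 1 + l" using n by (simp add: l_def)
    from canonical_line[of C l v f, folded nl, OF C v f refl Cv] obtain B C' where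
      "canonical_block B" "B \<in> carrier_mat 1 1" "C' \<in> carrier_mat l l" "real_congruent n C (B \<oplus>\<^sub>d C')" .
    then show thesis using split_found[of 1 l B C'] nl by simp
  qed
  have d0: "0 \<le> d i" if i: "i < n" for i
  proof -
    have "(C *\<^sub>v unit_vec n i) \<bullet>c unit_vec n i = (C *\<^sub>v unit_vec n i) \<bullet> unit_vec n i"
      by (rule arg_cong[of _ _ "\<lambda>y. _ \<bullet> y"]) (auto intro!: eq_vecI simp: unit_vec_def)
    also have "\<dots> = C $$ (i, i)" using C i by simp
    finally show ?thesis using C(3) i by (simp add: accretive_def d_def) (metis unit_vec_carrier)
  qed
  \<comment> \<open>For \<open>v\<close> in \<open>ker P\<close> the value \<open>v^T C v\<close> is
    \<open>\<i>\<close> times \<open>v . b\<close>, so \<open>C v\<close> divided by it is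
    real.\<close>
  have line_imag: thesis if v: "v \<in> carrier_vec n" "v \<noteq> 0\<^sub>v n" and b: "b \<in> carrier_vec n"
    and Cv: "C *\<^sub>v cvec v = \<i> \<cdot>\<^sub>v cvec b" and nz: "v \<bullet> b \<noteq> 0" for v b
  proof (rule line[OF v, of "(1 / (v \<bullet> b)) \<cdot>\<^sub>v b"])
    have a: "cvec v \<bullet> (C *\<^sub>v cvec v) = \<i> * of_real (v \<bullet> b)"
      unfolding Cv using v b by (simp add: scalar_prod_cvec)
    show "C *\<^sub>v cvec v = (cvec v \<bullet> (C *\<^sub>v cvec v)) \<cdot>\<^sub>v cvec ((1 / (v \<bullet> b)) \<cdot>\<^sub>v b)"
      unfolding a unfolding Cv using nz b by (intro eq_vecI) auto
  qed (use b in simp)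
  show thesis
  proof (cases "\<exists>i<n. \<exists>j<n. d i = 0 \<and> d j = 0 \<and> Q i j \<noteq> 0")
    case True
    then obtain i0 j0 where ij0: "i0 < n" "j0 < n" "d i0 = 0" "d j0 = 0" "Q i0 j0 \<noteq> 0" by blast
    have "\<exists>i<n. \<exists>j<n. d i = 0 \<and> d j = 0 \<and> Q i i + Q i j + Q j i + Q j j \<noteq> 0"
    \<comment> \<open>Polarization again, now restricted to the kernel coordinates of
      \<open>P\<close>.\<close>
    proof (rule ccontr)
      assume "\<not> ?thesis"
      then have z: "Q i i + Q i j + Q j i + Q j j = 0" if "i < n" "j < n" "d i = 0" "d j = 0" for i j
        using that by blast
      have "4 * Q i i = 0" if "i < n" "d i = 0" for i using z[OF that(1,1) that(2,2)] by simp
      then show False using z[OF ij0(1-4)] Qsym[OF ij0(1,2)] ij0 by simp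
    qed
    then obtain i j where ij: "i < n" "j < n" "d i = 0" "d j = 0"
      and nz: "Q i i + Q i j + Q j i + Q j j \<noteq> 0" by blast
    define v :: "real vec" where "v = unit_vec n i + unit_vec n j"
    note v = unit_vec_add_form[OF C(1) ij(1,2), folded v_def]
    define b where "b = vec n (\<lambda>k. Q k i + Q k j)"
    have Cv: "C *\<^sub>v cvec v = \<i> \<cdot>\<^sub>v cvec b"
      unfolding v(3) using ij C by (intro eq_vecI) (auto simp: b_def Cij algebra_simps)
    have "complex_of_real (v \<bullet> b) * \<i> = cvec v \<bullet> (C *\<^sub>v cvec v)"
      unfolding Cv using v(1) by (simp add: b_def scalar_prod_cvec)
    also have "\<dots> = of_real (Q i i + Q i j + Q j i + Q j j) * \<i>"
      unfolding v(4) using ij by (auto simp: Cij algebra_simps)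
    finally have "v \<bullet> b = Q i i + Q i j + Q j i + Q j j" by (simp add: complex_eq_iff)
    then show thesis using line_imag[OF v(1,2) _ Cv] nz by (simp add: b_def)
  next
    case no_imag: False
    show thesis
    proof (cases "\<exists>i<n. d i = 0")
      case True
      then obtain i where i: "i < n" "d i = 0" by blast
      define v :: "real vec" where "v = unit_vec n i"
      define b where "b = vec n (\<lambda>k. Q k i)"
      have v: "v \<in> carrier_vec n" "v \<noteq> 0\<^sub>v n" using i by (auto simp: v_def)
      have b: "b \<in> carrier_vec n" by (simp add: b_def)
      have Cv: "C *\<^sub>v cvec v = \<i> \<cdot>\<^sub>v cvec b"
      proof (rule eq_vecI)
        fix k assume "k < dim_vec (\<i> \<cdot>\<^sub>v cvec b)"
        then have k: "k < n" by (simp add: b_def)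
        have "(\<Sum>j<n. Q k j * v $ j) = (\<Sum>j<n. if j = i then Q k j else 0)"
          by (intro sum.cong) (auto simp: v_def i)
        also have "\<dots> = Q k i" using i by simp
        finally show "(C *\<^sub>v cvec v) $ k = (\<i> \<cdot>\<^sub>v cvec b) $ k"
          using Cx[OF k v(1)] k i by (auto simp: b_def v_def)
      qed (use C b in auto)
      \<comment> \<open>The failure of the preceding case puts \<open>Q v\<close> into the range of
        \<open>P\<close>.\<close>
      have b0: "b $ k = 0" if "k < n" "d k = 0" for k using no_imag i that by (auto simp: b_def)
      show thesis
      proof (cases "b = 0\<^sub>v n")
        case True
        \<comment> \<open>A common kernel vector of \<open>P\<close> and \<open>Q\<close> splits off
          a zero line, with \<open>a = 0\<close> and \<open>f = 0\<close>.\<close>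
        then have "C *\<^sub>v cvec v = 0\<^sub>v n" unfolding Cv by auto
        moreover have "0 \<cdot>\<^sub>v cvec (0\<^sub>v n) = 0\<^sub>v n" by (rule eq_vecI) auto
        ultimately show thesis using line[OF v, of "0\<^sub>v n"] v(1) by simp
      next
        case False
        \<comment> \<open>Solves \<open>P w = b\<close>. Where \<open>d k = 0\<close>, division by
          zero gives \<open>w k = 0\<close>, which is consistent because \<open>b k = 0\<close>
          there.\<close>
        define w where "w = vec n (\<lambda>k. b $ k / d k)"
        define q where "q = vec n (\<lambda>k. \<Sum>j<n. Q k j * w $ j)"
        have w: "w \<in> carrier_vec n" and q: "q \<in> carrier_vec n" by (auto simp: w_def q_def)
        have Cw: "C *\<^sub>v cvec w = cvec b + \<i> \<cdot>\<^sub>v cvec q"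
        proof (rule eq_vecI)
          fix k assume "k < dim_vec (cvec b + \<i> \<cdot>\<^sub>v cvec q)"
          then have k: "k < n" by (simp add: q_def)
          have "d k * w $ k = b $ k" using b0[OF k] k by (auto simp: w_def)
          then show "(C *\<^sub>v cvec w) $ k = (cvec b + \<i> \<cdot>\<^sub>v cvec q) $ k"
            using Cx[OF k w] k b by (simp add: q_def)
        qed (use C q in auto)
        have bi: "b $ i = 0" using b0 i by simp
        have bv: "b \<bullet> v = 0" using b i bi by (simp add: v_def)
        obtain k where k: "k < n" "b $ k \<noteq> 0" using False b by (metis carrier_vecD eq_vecI index_zero_vec)
        \<comment> \<open>\<open>b . w\<close> is the sum of the \<open>(b k)^2 / d k\<close>; a
          nonzero \<open>b k\<close> rules out \<open>d k = 0\<close>.\<close>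
        have "0 < b $ k * (b $ k / d k)"
        proof -
          have "0 < d k" using d0[OF k(1)] b0[OF k(1)] k(2) by fastforce
          then show ?thesis using k(2) by (simp add: zero_less_mult_iff zero_less_divide_iff) linarith
        qed
        also have "\<dots> \<le> (\<Sum>k<n. b $ k * (b $ k / d k))"
          using k d0 by (intro member_le_sum) auto
        also have "\<dots> = b \<bullet> w" by (simp add: w_def scalar_prod_def atLeast0LessThan)
        finally have bw: "0 < b \<bullet> w" .
        \<comment> \<open>Two distinct indices show that a plane fits, so the subtraction
          \<open>n - 2\<close> is exact.\<close>
        have "i \<noteq> k" using bi k by auto
        then have "n = 2 + (n - 2)" using i k by auto
        from canonical_step_pair[OF C(1,2) v(1) w b q Cv Cw bv bw this] obtain C' where
          "C' \<in> carrier_mat (n - 2) (n - 2)" "real_congruent n C (E_cell \<oplus>\<^sub>d C')" .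
        then show thesis using split_found[of 2 "n - 2" E_cell C'] \<open>n = 2 + (n - 2)\<close>
          by (simp add: canonical_block_def)
      qed
    next
      case False
      then have dpos: "0 < d i" if "i < n" for i using d0[OF that] that by fastforce
      obtain r y where y: "y \<in> carrier_vec n" "y \<noteq> 0\<^sub>v n"
        and ev: "\<And>i. i < n \<Longrightarrow> (\<Sum>j<n. Q i j * y $ j) = r * d i * y $ i"
        using ex_real_generalized_eigenvector[of n Q d, OF n Qsym dpos] by metis
      define g where "g = vec n (\<lambda>i. d i * y $ i)"
      have g: "g \<in> carrier_vec n" by (simp add: g_def)
      \<comment> \<open>From \<open>Q y = r P y\<close> one gets
        \<open>C y = (1 + \<i> r) P y\<close>, where \<open>g = P y\<close> is real.\<close>
      define z where "z = Complex 1 r"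
      have Cy: "C *\<^sub>v cvec y = z \<cdot>\<^sub>v cvec g"
      proof (rule eq_vecI)
        fix i assume "i < dim_vec (z \<cdot>\<^sub>v cvec g)"
        then have i: "i < n" by (simp add: g_def)
        have "(C *\<^sub>v cvec y) $ i = of_real (d i * y $ i) + \<i> * of_real (r * d i * y $ i)"
          using Cx[OF i y(1)] ev[OF i] by simp
        also have "\<dots> = z * of_real (d i * y $ i)" by (simp add: z_def complex_eq_iff)
        finally show "(C *\<^sub>v cvec y) $ i = (z \<cdot>\<^sub>v cvec g) $ i" using i by (simp add: g_def)
      qed (use C g in auto)
      have a: "cvec y \<bullet> (C *\<^sub>v cvec y) = z * of_real (y \<bullet> g)"
        unfolding Cy using y g by (simp add: scalar_prod_cvec)
      obtain k where k: "k < n" "y $ k \<noteq> 0" using y by (metis carrier_vecD eq_vecI index_zero_vec)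
      have "0 < y $ k * (d k * y $ k)" using dpos[OF k(1)] k(2)
        by (metis mult.left_commute mult_pos_pos not_real_square_gt_zero)
      also have "\<dots> \<le> (\<Sum>k<n. y $ k * (d k * y $ k))"
        using k d0 by (intro member_le_sum) (auto simp: mult.left_commute)
      also have "\<dots> = y \<bullet> g" by (simp add: g_def scalar_prod_def atLeast0LessThan)
      finally have pos: "0 < y \<bullet> g" .
      show thesis
      proof (rule line[OF y, of "(1 / (y \<bullet> g)) \<cdot>\<^sub>v g"])
        show "C *\<^sub>v cvec y = (cvec y \<bullet> (C *\<^sub>v cvec y)) \<cdot>\<^sub>v cvec ((1 / (y \<bullet> g)) \<cdot>\<^sub>v g)"
          unfolding a unfolding Cy using pos g by (intro eq_vecI) auto
      qed (use g in simp)
    qed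
  qed
qed

text \<open>The induction is strong because one or two dimensions are removed. The real part is
  diagonalized anew in each round, since the elimination need not leave a diagonal one on the
  complement.\<close>

lemma canonical_form:
  assumes "C \<in> carrier_mat n n" "C\<^sup>T = C" "accretive n C"
  shows "\<exists>Bs. (\<forall>B\<in>set Bs. canonical_block B) \<and> real_congruent n C (diag_block_mat Bs)"
  using assms
proof (induction n arbitrary: C rule: less_induct)
  case (less n)
  show ?case
  proof (cases "n = 0")
    case True
    then have "C = diag_block_mat []" using less.prems(1) by auto
    then show ?thesis using less.prems(1) real_congruent_refl by (metis empty_iff list.set(1))
  next
    case False
    obtain D where D: "real_congruent n C D" "\<And>i j. i < n \<Longrightarrow> j < n \<Longrightarrow> i \<noteq> j \<Longrightarrow> Re (D $$ (i, j)) = 0"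
      using ex_congruent_diagonal_real_part[OF less.prems(1,2)] by blast
    note Dp = real_congruent_carrier[OF D(1), THEN conjunct2] real_congruent_symmetric[OF D(1) less.prems(2)]
      real_congruent_accretive[OF D(1) less.prems(3)]
    obtain k l B C' where kl: "n = k + l" "0 < k" and B: "canonical_block B" "B \<in> carrier_mat k k"
      and C': "C' \<in> carrier_mat l l" and DB: "real_congruent n D (B \<oplus>\<^sub>d C')"
      using canonical_step_diagonal[OF Dp _ D(2)] False by blast
    have "C'\<^sup>T = C'"
      using direct_sum_symmetric[OF B(2) C'] real_congruent_symmetric[OF DB Dp(2)] by simp
    moreover have "accretive l C'"
      using real_congruent_accretive[OF DB Dp(3)] accretive_direct_sum_iff[OF B(2) C'] kl by simp
    ultimately obtain Bs where Bs: "\<forall>B\<in>set Bs. canonical_block B" "real_congruent l C' (diag_block_mat Bs)"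
      using less.IH[OF _ C'] kl by auto
    have "real_congruent n (B \<oplus>\<^sub>d C') (diag_block_mat (B # Bs))"
      unfolding diag_block_mat_Cons kl(1) by (intro real_congruent_direct_sum real_congruent_refl B Bs)
    then have "real_congruent n C (diag_block_mat (B # Bs))"
      using D(1) DB real_congruent_trans by blast
    then show ?thesis using B(1) Bs(1) by (intro exI[of _ "B # Bs"]) auto
  qed
qed

subsection \<open>The normal form\<close>

lemma canonical_block_square: "canonical_block B \<Longrightarrow> dim_col B = dim_row B"
  by (auto simp: canonical_block_def phase_mat_def carrier_matD[OF E_cell_carrier])

lemma canonical_block_symmetric: "canonical_block B \<Longrightarrow> B\<^sup>T = B"
  by (auto simp: canonical_block_def phase_mat_def carrier_matD[OF E_cell_carrier] less_2_cases_iff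
      intro!: eq_matI)

lemma phase_mat_accretive: "\<bar>t\<bar> \<le> pi / 2 \<Longrightarrow> accretive 1 (phase_mat t)"
proof -
  assume t: "\<bar>t\<bar> \<le> pi / 2"
  have "0 \<le> Re ((phase_mat t *\<^sub>v x) \<bullet>c x)" if "x \<in> carrier_vec 1" for x
  proof -
    have "(phase_mat t *\<^sub>v x) \<bullet>c x = cis t * of_real ((cmod (x $ 0))\<^sup>2)"
      using that by (simp add: phase_mat_def scalar_prod_def mult.assoc flip: complex_norm_square)
    moreover have "0 \<le> cos t" using t by (intro cos_ge_zero) auto
    ultimately show ?thesis by (simp add: complex_eq_iff)
  qed
  then show ?thesis by (auto simp: accretive_def phase_mat_def)
qed

text \<open>The off-diagonal terms contribute \<open>- \<i>\<close> times a real number, so the real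
  part of the form is the squared modulus of the second coordinate.\<close>

lemma E_cell_accretive: "accretive 2 E_cell"
proof -
  have "0 \<le> Re ((E_cell *\<^sub>v x) \<bullet>c x)" if "x \<in> carrier_vec 2" for x
  proof -
    have eq: "(E_cell *\<^sub>v x) \<bullet>c x = - \<i> * x $ 1 * cnj (x $ 0) + (- \<i> * x $ 0 + x $ 1) * cnj (x $ 1)"
      using that by (simp add: scalar_prod_def numeral_2_eq_2 row_def carrier_matD[OF E_cell_carrier])
    have "Re ((E_cell *\<^sub>v x) \<bullet>c x) = (Re (x $ 1))\<^sup>2 + (Im (x $ 1))\<^sup>2"
      unfolding eq by (simp add: algebra_simps power2_eq_square)
    then show ?thesis by simp
  qed
  then show ?thesis by (auto simp: accretive_def)
qed

lemma canonical_block_accretive: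
  assumes "canonical_block B"
  shows "accretive (dim_row B) B"
proof -
  have "accretive 1 (0\<^sub>m 1 1)" by (auto simp: accretive_def scalar_prod_def)
  moreover have "dim_row (phase_mat t) = 1" for t by (simp add: phase_mat_def)
  ultimately show ?thesis
    using assms phase_mat_accretive E_cell_accretive carrier_matD(1)[OF E_cell_carrier]
    unfolding canonical_block_def by auto
qed

lemma canonical_diag_block_mat:
  assumes "\<forall>B\<in>set Bs. canonical_block B"
  shows "(diag_block_mat Bs)\<^sup>T = diag_block_mat Bs \<and>
    accretive (sum_list (map dim_row Bs)) (diag_block_mat Bs)"
  using assms
proof (induction Bs)
  case Nil
  then show ?case by (auto simp: accretive_def scalar_prod_def)
next
  case (Cons B Bs)
  let ?d = "sum_list (map dim_row Bs)"
  have 1: "B \<in> carrier_mat (dim_row B) (dim_row B)"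
    using Cons.prems canonical_block_square[of B] by (intro carrier_matI) auto
  have 2: "diag_block_mat Bs \<in> carrier_mat ?d ?d"
    using Cons.prems canonical_block_square by (intro diag_block_mat_carrier) auto
  show ?case
    using Cons canonical_block_symmetric[of B] canonical_block_accretive[of B]
    unfolding diag_block_mat_Cons list.map sum_list.Cons
    by (simp add: direct_sum_transpose[OF 1 2] accretive_direct_sum_iff[OF 1 2])
qed

text \<open>Prepares the rank count: only the zero lines reduce the rank.\<close>

lemma canonical_diag_block_mat_det:
  assumes "\<forall>B\<in>set Bs. canonical_block B \<and> B \<noteq> 0\<^sub>m 1 1"
  shows "det (diag_block_mat Bs) \<noteq> 0"
  using assms
proof (induction Bs)
  case Nil
  then show ?case by simp
next
  case (Cons B Bs)
  let ?d = "sum_list (map dim_row Bs)"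
  have 1: "B \<in> carrier_mat (dim_row B) (dim_row B)"
    using Cons.prems canonical_block_square[of B] by (intro carrier_matI) auto
  have 2: "diag_block_mat Bs \<in> carrier_mat ?d ?d"
    using Cons.prems canonical_block_square by (intro diag_block_mat_carrier) auto
  have "det (phase_mat t) \<noteq> 0" for t
    by (subst det_single) (auto simp: phase_mat_def)
  moreover have "det E_cell \<noteq> 0"
  proof
    \<comment> \<open>The inverse of the cell.\<close>
    define F :: "complex mat" where "F = mat_of_rows_list 2 [[1, \<i>], [\<i>, 0]]"
    have F: "F \<in> carrier_mat 2 2" unfolding F_def mat_of_rows_list_def by (rule carrier_matI) simp_all
    have "E_cell * F = 1\<^sub>m 2"
      using F by (intro eq_matI)
        (auto simp: F_def mat_of_rows_list_def less_Suc_eq scalar_prod_def numeral_2_eq_2 row_def col_def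
          carrier_matD[OF E_cell_carrier])
    then have "det E_cell * det F = 1" using F by (metis E_cell_carrier det_mult det_one)
    moreover assume "det E_cell = 0"
    ultimately show False by simp
  qed
  ultimately have "det B \<noteq> 0" using Cons.prems by (auto simp: canonical_block_def)
  then show ?case using Cons unfolding diag_block_mat_Cons direct_sum_det[OF 1 2] by simp
qed

text \<open>An equality of multisets suffices, because reordering diagonal blocks is a real
  congruence.\<close>

lemma canonical_blocks_sort:
  assumes "\<forall>B\<in>set Bs. canonical_block B"
  obtains z ts k where "sorted_wrt (\<ge>) ts" "\<forall>t\<in>set ts. \<bar>t\<bar> \<le> pi / 2"
    "mset Bs = mset (replicate z (0\<^sub>m 1 1) @ map phase_mat ts @ replicate k E_cell)"
proof -
  have "\<exists>z ts k. sorted_wrt (\<ge>) ts \<and> (\<forall>t\<in>set ts. \<bar>t\<bar> \<le> pi / 2) \<and>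
    mset Bs = mset (replicate z (0\<^sub>m 1 1) @ map phase_mat ts @ replicate k E_cell)"
    using assms
  proof (induction Bs)
    case Nil
    then show ?case by (intro exI[of _ 0] exI[of _ "[]"]) simp
  next
    case (Cons B Bs)
    then obtain z ts k where IH: "sorted_wrt (\<ge>) ts" "\<forall>t\<in>set ts. \<bar>t\<bar> \<le> pi / 2"
      "mset Bs = mset (replicate z (0\<^sub>m 1 1) @ map phase_mat ts @ replicate k E_cell)" by auto
    from Cons.prems consider "B = 0\<^sub>m 1 1" | t where "\<bar>t\<bar> \<le> pi / 2" "B = phase_mat t" | "B = E_cell"
      by (auto simp: canonical_block_def)
    then show ?case
    proof cases
      case 1
      then show ?thesis using IH by - (rule exI[of _ "Suc z"], rule exI[of _ ts], rule exI[of _ k], simp)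
    next
      case 2
      have "mset (rev (sort (t # ts))) = add_mset t (mset ts)" by simp
      then have "mset (map phase_mat (rev (sort (t # ts)))) = add_mset B (mset (map phase_mat ts))"
        using 2 by (simp only: mset_map) simp
      moreover have "sorted_wrt (\<ge>) (rev (sort (t # ts)))"
        unfolding sorted_wrt_rev by (rule sorted_sort)
      ultimately show ?thesis using IH 2
        by - (rule exI[of _ z], rule exI[of _ "rev (sort (t # ts))"], rule exI[of _ k], simp add: set_insort_key)
    next
      case 3
      then show ?thesis using IH by - (rule exI[of _ z], rule exI[of _ ts], rule exI[of _ "Suc k"], simp)
    qed
  qed
  then show ?thesis using that by blast
qed

lemma diag_block_mat_zeros: "diag_block_mat (replicate z (0\<^sub>m 1 1 :: 'a :: zero mat)) = 0\<^sub>m z z"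
proof (induction z)
  case (Suc z)
  have "0\<^sub>m 1 1 \<oplus>\<^sub>d 0\<^sub>m z z = (0\<^sub>m (Suc z) (Suc z) :: 'a mat)"
    by (rule eq_matI) (auto simp: direct_sum_def)
  then show ?case using Suc unfolding replicate_Suc diag_block_mat_Cons by simp
qed simp

lemma diag_block_mat_phases: "diag_block_mat (map phase_mat ts) = D_block (length ts) ((!) ts)"
proof (induction ts)
  case (Cons t ts)
  have "phase_mat t \<oplus>\<^sub>d D_block (length ts) ((!) ts) = D_block (length (t # ts)) ((!) (t # ts))"
    by (rule eq_matI) (auto simp: direct_sum_def D_block_def mat_diag_def phase_mat_def nth_Cons')
  then show ?case using Cons unfolding list.map diag_block_mat_Cons by simp
qed (auto simp: D_block_def mat_diag_def)

lemma transpose_smult_mat: "(c \<cdot>\<^sub>m A)\<^sup>T = c \<cdot>\<^sub>m A\<^sup>T"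
  by (rule eq_matI) auto

lemma smult_direct_sum:
  fixes c :: "'a :: mult_zero"
  shows "c \<cdot>\<^sub>m (A \<oplus>\<^sub>d B) = (c \<cdot>\<^sub>m A) \<oplus>\<^sub>d (c \<cdot>\<^sub>m B)"
  unfolding smult_mat_def by (rule direct_sum_map) simp

text \<open>Taking out \<open>cis \<theta>\<close> leaves the zero block as it is, lowers the angles
  of \<open>D_block\<close> by \<open>\<theta>\<close> and reduces \<open>E_block\<close> to bare
  cells. Both directions of the theorem use it to pass between the normal form and canonical
  blocks.\<close>

lemma normal_form_eq_smult:
  "diag_block_mat [0\<^sub>m z z, D_block m \<phi>, E_block \<theta> k] = cis \<theta> \<cdot>\<^sub>m diag_block_mat
     (replicate z (0\<^sub>m 1 1) @ map phase_mat (map (\<lambda>i. \<phi> i - \<theta>) [0..<m]) @ replicate k E_cell)"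
proof -
  have D: "D_block m \<phi> = cis \<theta> \<cdot>\<^sub>m diag_block_mat (map phase_mat (map (\<lambda>i. \<phi> i - \<theta>) [0..<m]))"
    unfolding diag_block_mat_phases by (rule eq_matI) (auto simp: D_block_def mat_diag_def cis_mult)
  have E: "E_block \<theta> k = cis \<theta> \<cdot>\<^sub>m diag_block_mat (replicate k E_cell)"
    by (simp add: E_block_def E_cell_def)
  have Z: "0\<^sub>m z z = cis \<theta> \<cdot>\<^sub>m (0\<^sub>m z z)" by auto
  show ?thesis
    unfolding diag_block_mat_append_direct_sum diag_block_mat_zeros smult_direct_sum
    unfolding D[symmetric] E[symmetric] Z[symmetric] diag_block_mat_Cons[of "0\<^sub>m z z"] diag_block_mat_Cons[of "D_block m \<phi>"]
      diag_block_mat_singleton ..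
qed

section \<open>Semi-sectorial matrices as rotated accretive ones\<close>

lemma smult_quadratic_form:
  fixes C :: "complex mat"
  assumes "C \<in> carrier_mat n n" "x \<in> carrier_vec n"
  shows "((c \<cdot>\<^sub>m C) *\<^sub>v x) \<bullet>c x = c * ((C *\<^sub>v x) \<bullet>c x)"
proof -
  have "(c \<cdot>\<^sub>m C) *\<^sub>v x = c \<cdot>\<^sub>v (C *\<^sub>v x)" using assms by (intro eq_vecI) auto
  then show ?thesis using assms by simp
qed

text \<open>The angle is that of the inner normal \<open>a\<close>: multiplication by
  \<open>cis (- Arg a)\<close> turns its half-plane into the right one. Conversely
  \<open>cis \<theta>\<close> serves as normal.\<close>

lemma semi_sectorial_iff_accretive:
  assumes C: "C \<in> carrier_mat n n"
  shows "semi_sectorial n C \<longleftrightarrow> (\<exists>\<theta>. accretive n (cis (- \<theta>) \<cdot>\<^sub>m C))"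
proof
  assume "semi_sectorial n C"
  then obtain a where a: "a \<noteq> 0" and W: "numerical_range n C \<subseteq> closed_half_plane a"
    by (auto simp: semi_sectorial_def)
  have Re_real_mult: "Re (of_real c * w) = c * Re w" for c w by simp
  have ca: "cnj a = of_real (cmod a) * cis (- Arg a)"
    by (metis cis_cnj complex_cnj_complex_of_real complex_cnj_mult rcis_cmod_Arg rcis_def)
  have "0 \<le> Re (cis (- Arg a) * ((C *\<^sub>v x) \<bullet>c x))" if x: "x \<in> carrier_vec n" for x
  proof (cases "x = 0\<^sub>v n")
    case True
    then show ?thesis using C by (simp add: scalar_prod_def)
  next
    case False
    \<comment> \<open>The squared norm of \<open>x\<close>. Scaling \<open>x\<close> by
      \<open>1 / sqrt s\<close> reaches the unit vectors of the numerical range and multiplies the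
      form by the positive number \<open>1 / s\<close>.\<close>
    define s where "s = Re (x \<bullet>c x)"
    have s_sum: "s = (\<Sum>i<n. (cmod (x $ i))\<^sup>2)"
    proof -
      have "x \<bullet>c x = of_real (\<Sum>i<n. (cmod (x $ i))\<^sup>2)"
        unfolding of_real_sum complex_norm_square using x by (simp add: scalar_prod_def atLeast0LessThan)
      then show ?thesis unfolding s_def by simp
    qed
    obtain i where i: "i < n" "x $ i \<noteq> 0" using x False by (metis carrier_vecD eq_vecI index_zero_vec)
    have "0 < (cmod (x $ i))\<^sup>2" using i by simp
    also have "\<dots> \<le> s" unfolding s_sum using i by (intro member_le_sum) auto
    finally have s: "0 < s" .
    define c where "c = complex_of_real (1 / sqrt s)"
    define y where "y = c \<cdot>\<^sub>v x"
    have cc: "c * cnj c = of_real (1 / s)" using s by (simp add: c_def flip: of_real_mult)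
    have y: "y \<in> carrier_vec n" using x by (simp add: y_def)
    have "y \<bullet>c y = c * cnj c * (x \<bullet>c x)"
      using x by (simp add: y_def scalar_prod_def sum_distrib_left mult_ac)
    then have "euclidean_norm y = 1" using s unfolding cc euclidean_norm_def by (simp add: s_def)
    then have "(C *\<^sub>v y) \<bullet>c y \<in> closed_half_plane a" using W y by (auto simp: numerical_range_def)
    moreover have "(C *\<^sub>v y) \<bullet>c y = of_real (1 / s) * ((C *\<^sub>v x) \<bullet>c x)"
      unfolding cc[symmetric] using x C
      by (simp add: y_def mult_mat_vec[of _ n n] conjugate_smult_vec mult.assoc)
    ultimately have "0 \<le> Re (of_real (cmod a) * cis (- Arg a) * (of_real (1 / s) * ((C *\<^sub>v x) \<bullet>c x)))"
      by (simp only: closed_half_plane_def ca mem_Collect_eq)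
    also have "of_real (cmod a) * cis (- Arg a) * (of_real (1 / s) * ((C *\<^sub>v x) \<bullet>c x)) =
      of_real (cmod a / s) * (cis (- Arg a) * ((C *\<^sub>v x) \<bullet>c x))" by simp
    finally have "0 \<le> cmod a / s * Re (cis (- Arg a) * ((C *\<^sub>v x) \<bullet>c x))"
      by (simp only: Re_real_mult)
    then show ?thesis using s a by (simp add: zero_le_mult_iff zero_le_divide_iff)
  qed
  then have "accretive n (cis (- Arg a) \<cdot>\<^sub>m C)"
    unfolding accretive_def using smult_quadratic_form[OF C] C by simp
  then show "\<exists>\<theta>. accretive n (cis (- \<theta>) \<cdot>\<^sub>m C)" ..
next
  assume "\<exists>\<theta>. accretive n (cis (- \<theta>) \<cdot>\<^sub>m C)"
  then obtain \<theta> where "accretive n (cis (- \<theta>) \<cdot>\<^sub>m C)" ..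
  then have "0 \<le> Re (cnj (cis \<theta>) * ((C *\<^sub>v x) \<bullet>c x))" if "x \<in> carrier_vec n" for x
    using that unfolding accretive_def cis_cnj smult_quadratic_form[OF C that, symmetric] by blast
  then show "semi_sectorial n C"
    unfolding semi_sectorial_def
    by (intro exI[of _ "cis \<theta>"]) (auto simp: numerical_range_def closed_half_plane_def)
qed

lemma real_congruent_smult:
  assumes "real_congruent n A B"
  shows "real_congruent n (c \<cdot>\<^sub>m A) (c \<cdot>\<^sub>m B)"
proof -
  from assms obtain S where *: "A \<in> carrier_mat n n" "S \<in> carrier_mat n n" "det S \<noteq> 0"
    "B = cmat S\<^sup>T * A * cmat S"
    by (auto simp: real_congruent_def)
  show ?thesis
    using * by (intro real_congruentI[of _ _ S])
      (auto simp: mult_smult_distrib[of _ n n _ n] mult_smult_assoc_mat[of _ n n _ n])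
qed

section \<open>The rank of the normal form\<close>

text \<open>The column space is the row space of the transpose, on which \<open>P^T\<close> acts
  from the left as an invertible row operation.\<close>

lemma rank_mult_invertible_right:
  fixes A :: "complex mat"
  assumes A: "A \<in> carrier_mat n n" and P: "P \<in> carrier_mat n n" "det P \<noteq> 0"
  shows "vec_space.rank n (A * P) = vec_space.rank n A"
proof -
  interpret vec_space "TYPE(complex)" n .
  have "invertible_mat P\<^sup>T"
    using P invertible_mat_iff_det[of "P\<^sup>T" n] det_transpose[OF P(1)] by simp
  then have "row_space (P\<^sup>T * A\<^sup>T) = row_space A\<^sup>T"
    by (rule row_space_is_preserved) (use A P in auto)
  then have "col_space (A * P) = col_space A"
    using A P by (simp add: col_space_eq_row_space_transpose transpose_mult[of _ n n _ n])
  then show ?thesis unfolding rank_def col_space_def by simp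
qed

text \<open>The right factor replaces the leading \<open>z\<close> columns of \<open>G\<close> by
  zero and keeps the others, which are independent.\<close>

lemma rank_zero_cols:
  fixes G :: "complex mat"
  assumes G: "G \<in> carrier_mat (z + r) (z + r)" "det G \<noteq> 0"
  shows "vec_space.rank (z + r) (G * (0\<^sub>m z z \<oplus>\<^sub>d 1\<^sub>m r)) = r"
proof -
  interpret vec_space "TYPE(complex)" "z + r" .
  let ?J = "0\<^sub>m z z \<oplus>\<^sub>d 1\<^sub>m r :: complex mat"
  let ?A = "G * ?J"
  have J: "?J \<in> carrier_mat (z + r) (z + r)" by simp
  have A: "?A \<in> carrier_mat (z + r) (z + r)" using G J by simp
  have colJ: "col ?J j = (if j < z then 0\<^sub>v (z + r) else unit_vec (z + r) j)" if "j < z + r" for j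
    using that by (intro eq_vecI) (auto simp: direct_sum_def unit_vec_def)
  have colA: "col ?A j = (if j < z then 0\<^sub>v (z + r) else col G j)" if j: "j < z + r" for j
  proof -
    have "col ?A j = G *\<^sub>v col ?J j" using col_mult2[OF G(1) J j] .
    then show ?thesis unfolding colJ[OF j] using G j by (auto intro!: eq_vecI)
  qed
  have "rank G = z + r" using det_rank_iff[OF G(1)] G(2) by simp
  then have dist: "distinct (cols G)" and indep: "lin_indpt (set (cols G))"
    using non_distinct_low_rank[OF G(1)] full_rank_lin_indpt[OF G(1)] by auto
  define S where "S = col G ` {z..<z + r}"
  have S_sub: "S \<subseteq> set (cols G)" using G by (auto simp: S_def cols_def)
  have inj: "inj_on (col G) {z..<z + r}"
  proof (rule inj_onI)
    fix i j assume "i \<in> {z..<z + r}" "j \<in> {z..<z + r}" and e: "col G i = col G j"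
    then have ij: "i < length (cols G)" "j < length (cols G)" using G by auto
    then have "cols G ! i = cols G ! j" using e by simp
    then show "i = j" using nth_eq_iff_index_eq[OF dist ij] by simp
  qed
  have "card S = r" unfolding S_def using card_image[OF inj] by simp
  \<comment> \<open>The rank is the size of a maximal independent set of columns. Besides
    \<open>S\<close> only the zero vector occurs among the columns, and no independent set contains
    it.\<close>
  moreover have "maximal S (\<lambda>T. T \<subseteq> set (cols ?A) \<and> lin_indpt T)"
    unfolding maximal_def
  proof (intro conjI allI impI)
    have "col G j \<in> set (cols ?A)" if "z \<le> j" "j < z + r" for j
      using colA[of j] that A cols_nth[of j ?A] by (metis carrier_matD(2) cols_length leD nth_mem)
    then show "S \<subseteq> set (cols ?A)" by (auto simp: S_def)
    show "lin_indpt S" using subset_li_is_li[OF indep S_sub] .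
  next
    fix T assume T: "S \<subseteq> T \<and> T \<subseteq> set (cols ?A) \<and> lin_indpt T"
    have "T \<subseteq> carrier_vec (z + r)" using T cols_dim[of ?A] unfolding carrier_matD(1)[OF A] by blast
    moreover have "(UNIV :: complex set) \<noteq> {0}" by (metis UNIV_I singletonD zero_neq_one)
    ultimately have "0\<^sub>v (z + r) \<notin> T" using T zero_nin_lin_indpt[of T] by simp
    moreover have "x \<in> S \<or> x = 0\<^sub>v (z + r)" if x: "x \<in> set (cols ?A)" for x
    proof -
      from x obtain j where "j < length (cols ?A)" "x = cols ?A ! j" by (metis in_set_conv_nth)
      then have "j < z + r" "x = col ?A j" using carrier_matD(2)[OF A] by simp_all
      then show ?thesis using colA[of j] by (auto simp: S_def)
    qed
    ultimately show "T = S" using T by blast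
  qed
  ultimately show ?thesis using rank_card_indpt[OF A] by simp
qed

text \<open>The factorization of \<open>0 \<oplus> N\<close> into \<open>1 \<oplus> N\<close> and
  \<open>0 \<oplus> 1\<close> lets the left factor \<open>S^T\<close> merge with
  \<open>1 \<oplus> N\<close> into one invertible matrix.\<close>

lemma rank_congruent_direct_sum_zero:
  assumes "real_congruent (z + r) (0\<^sub>m z z \<oplus>\<^sub>d N) C" and N: "N \<in> carrier_mat r r" "det N \<noteq> 0"
  shows "vec_space.rank (z + r) C = r"
proof -
  obtain S where S: "S \<in> carrier_mat (z + r) (z + r)" "det S \<noteq> 0"
    and C: "C = cmat S\<^sup>T * (0\<^sub>m z z \<oplus>\<^sub>d N) * cmat S"
    using assms(1) by (auto simp: real_congruent_def)
  have dS: "det (cmat S) \<noteq> 0" using S(2) by (simp add: of_real_hom.hom_det)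
  then have dSt: "det (cmat S\<^sup>T) \<noteq> 0" using S(1) by (simp add: cmat_transpose det_transpose)
  let ?P = "1\<^sub>m z \<oplus>\<^sub>d N" and ?J = "0\<^sub>m z z \<oplus>\<^sub>d 1\<^sub>m r :: complex mat"
  have P: "?P \<in> carrier_mat (z + r) (z + r)" and J: "?J \<in> carrier_mat (z + r) (z + r)" using N by simp_all
  have "0\<^sub>m z z \<oplus>\<^sub>d N = ?P * ?J" using N by (simp add: direct_sum_mult[of _ z _ r])
  then have "cmat S\<^sup>T * (0\<^sub>m z z \<oplus>\<^sub>d N) = cmat S\<^sup>T * (?P * ?J)" by simp
  also have "\<dots> = (cmat S\<^sup>T * ?P) * ?J"
    by (rule assoc_mult_mat[symmetric, of _ "z + r" "z + r" _ "z + r" _ "z + r"]) (use S(1) P J in auto)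
  finally have "cmat S\<^sup>T * (0\<^sub>m z z \<oplus>\<^sub>d N) = (cmat S\<^sup>T * ?P) * ?J" .
  moreover have "det (cmat S\<^sup>T * ?P) \<noteq> 0"
    using S(1) P dSt N by (simp add: det_mult[of _ "z + r"] direct_sum_det[of _ z _ r])
  ultimately have "vec_space.rank (z + r) (cmat S\<^sup>T * (0\<^sub>m z z \<oplus>\<^sub>d N)) = r"
    using rank_zero_cols[of "cmat S\<^sup>T * ?P" z r] S(1) P by simp
  moreover have "vec_space.rank (z + r) C = vec_space.rank (z + r) (cmat S\<^sup>T * (0\<^sub>m z z \<oplus>\<^sub>d N))"
    unfolding C by (rule rank_mult_invertible_right) (use S(1) N dS in auto)
  ultimately show ?thesis by simp
qed

theorem theorem5:
  fixes n :: nat and C :: "complex mat"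
  assumes "C \<in> carrier_mat n n"
  defines "r \<equiv> vec_space.rank n C"
  shows "(complex_symmetric C \<and> semi_sectorial n C) \<longleftrightarrow>
    (\<exists>(T :: real mat) (\<theta>0 :: real) (m :: nat) (k :: nat) (\<phi> :: nat \<Rightarrow> real).
       T \<in> carrier_mat n n \<and> invertible_mat T \<and>
       r = m + 2 * k \<and>
       (\<forall>i<m. \<theta>0 - pi / 2 \<le> \<phi> i \<and> \<phi> i \<le> \<theta>0 + pi / 2) \<and>
       (\<forall>i j. i \<le> j \<and> j < m \<longrightarrow> \<phi> j \<le> \<phi> i) \<and>
       C = map_mat complex_of_real T\<^sup>T
           * diag_block_mat [0\<^sub>m (n - r) (n - r), D_block m \<phi>, E_block \<theta>0 k]
           * map_mat complex_of_real T)"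
    (is "?symmetric_sectorial \<longleftrightarrow> ?normal_form")
proof
  assume ?symmetric_sectorial
  then have Ct: "C\<^sup>T = C" and "semi_sectorial n C" by (auto simp: complex_symmetric_def)
  then obtain \<theta> where acc: "accretive n (cis (- \<theta>) \<cdot>\<^sub>m C)"
    using semi_sectorial_iff_accretive[OF assms(1)] by blast
  have rotC: "cis \<theta> \<cdot>\<^sub>m (cis (- \<theta>) \<cdot>\<^sub>m C) = C"
    by (rule eq_matI) (auto simp: cis_mult simp flip: mult.assoc)
  have "(cis (- \<theta>) \<cdot>\<^sub>m C)\<^sup>T = cis (- \<theta>) \<cdot>\<^sub>m C" using Ct by (simp add: transpose_smult_mat)
  then obtain Bs where Bs: "\<forall>B\<in>set Bs. canonical_block B"
    and CBs: "real_congruent n (cis (- \<theta>) \<cdot>\<^sub>m C) (diag_block_mat Bs)"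
    using canonical_form[OF _ _ acc] assms(1) by auto
  obtain z ts k where ts: "sorted_wrt (\<ge>) ts" "\<forall>t\<in>set ts. \<bar>t\<bar> \<le> pi / 2"
    and ms: "mset Bs = mset (replicate z (0\<^sub>m 1 1) @ map phase_mat ts @ replicate k E_cell)"
    using canonical_blocks_sort[OF Bs] .
  let ?Ns = "map phase_mat ts @ replicate k E_cell"
  let ?Bs' = "replicate z (0\<^sub>m 1 1) @ ?Ns"
  define m where "m = length ts"
  \<comment> \<open>The sorted angles are those of the rotated matrix; adding
    \<open>\<theta>\<close> undoes the rotation.\<close>
  define \<phi> where "\<phi> i = ts ! i + \<theta>" for i
  have canon: "\<forall>B\<in>set ?Bs'. canonical_block B"
    using Bs ms by (metis mset_eq_setD)
  have dB: "dim_row (phase_mat t) = 1" for t by (simp add: phase_mat_def)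
  have dN: "sum_list (map dim_row ?Ns) = m + 2 * k"
    by (simp add: o_def dB m_def sum_list_replicate map_replicate_const carrier_matD[OF E_cell_carrier])
  have N: "diag_block_mat ?Ns \<in> carrier_mat (m + 2 * k) (m + 2 * k)"
    using diag_block_mat_carrier[of ?Ns] canon canonical_block_square unfolding dN by auto
  have Bs'_eq: "diag_block_mat ?Bs' = 0\<^sub>m z z \<oplus>\<^sub>d diag_block_mat ?Ns"
    by (simp only: diag_block_mat_append_direct_sum diag_block_mat_zeros)
  have nonzero: "phase_mat t \<noteq> 0\<^sub>m 1 1" "E_cell \<noteq> 0\<^sub>m 1 1" for t
  proof -
    have "phase_mat t $$ (0, 0) \<noteq> 0\<^sub>m 1 1 $$ (0, 0)" by (simp add: phase_mat_def)
    then show "phase_mat t \<noteq> 0\<^sub>m 1 1" by metis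
    have "dim_row E_cell \<noteq> dim_row (0\<^sub>m 1 1 :: complex mat)"
      by (simp add: carrier_matD[OF E_cell_carrier])
    then show "E_cell \<noteq> 0\<^sub>m 1 1" by metis
  qed
  have detN: "det (diag_block_mat ?Ns) \<noteq> 0"
  proof (rule canonical_diag_block_mat_det, intro ballI conjI)
    fix B assume B: "B \<in> set ?Ns"
    then show "canonical_block B" using canon by simp
    from B have "(\<exists>t. B = phase_mat t) \<or> B = E_cell" by auto
    then show "B \<noteq> 0\<^sub>m 1 1" using nonzero by metis
  qed
  have dBs: "dim_row (diag_block_mat Bs) = n"
    using carrier_matD(1)[OF real_congruent_carrier[OF CBs, THEN conjunct2]] .
  have "real_congruent n (diag_block_mat Bs) (diag_block_mat ?Bs')"
    using real_congruent_diag_block_mat_mset[OF ms] Bs canonical_block_square dBs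
    by (simp add: dim_diag_block_mat)
  with CBs have rc: "real_congruent n (cis (- \<theta>) \<cdot>\<^sub>m C) (0\<^sub>m z z \<oplus>\<^sub>d diag_block_mat ?Ns)"
    unfolding Bs'_eq by (rule real_congruent_trans)
  \<comment> \<open>Comparing carriers ties \<open>z\<close> to the size of the nonzero blocks; the
    rank computation below turns it into \<open>n - r\<close>.\<close>
  then have n: "n = z + (m + 2 * k)"
    using real_congruent_carrier[OF rc] N by (auto simp: direct_sum_def)
  \<comment> \<open>The congruence is reversed here, because the claim expresses \<open>C\<close>
    through the normal form.\<close>
  have "real_congruent n (cis \<theta> \<cdot>\<^sub>m (0\<^sub>m z z \<oplus>\<^sub>d diag_block_mat ?Ns)) C"
    using real_congruent_smult[OF real_congruent_sym[OF rc], of "cis \<theta>"] unfolding rotC .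
  moreover have "cis \<theta> \<cdot>\<^sub>m (0\<^sub>m z z \<oplus>\<^sub>d diag_block_mat ?Ns) =
      diag_block_mat [0\<^sub>m z z, D_block m \<phi>, E_block \<theta> k]"
  proof -
    have "map (\<lambda>i. \<phi> i - \<theta>) [0..<m] = ts" by (simp add: \<phi>_def m_def map_nth)
    then show ?thesis unfolding normal_form_eq_smult Bs'_eq[symmetric] by simp
  qed
  ultimately have main: "real_congruent n (diag_block_mat [0\<^sub>m z z, D_block m \<phi>, E_block \<theta> k]) C" by simp
  have "r = m + 2 * k"
  proof -
    have "real_congruent n (0\<^sub>m z z \<oplus>\<^sub>d (cis \<theta> \<cdot>\<^sub>m diag_block_mat ?Ns)) C"
      using \<open>real_congruent n (cis \<theta> \<cdot>\<^sub>m (0\<^sub>m z z \<oplus>\<^sub>d diag_block_mat ?Ns)) C\<close>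
      by (simp add: smult_direct_sum)
    moreover have "det (cis \<theta> \<cdot>\<^sub>m diag_block_mat ?Ns) \<noteq> 0" using detN by simp
    ultimately show ?thesis
      unfolding r_def n using rank_congruent_direct_sum_zero N by (metis smult_carrier_mat)
  qed
  then have z: "z = n - r" using n by simp
  obtain T where T: "T \<in> carrier_mat n n" "det T \<noteq> 0"
    and CT: "C = cmat T\<^sup>T * diag_block_mat [0\<^sub>m (n - r) (n - r), D_block m \<phi>, E_block \<theta> k] * cmat T"
    using main unfolding z real_congruent_def by blast
  have range: "\<theta> - pi / 2 \<le> \<phi> i \<and> \<phi> i \<le> \<theta> + pi / 2" if "i < m" for i
  proof -
    have "\<bar>ts ! i\<bar> \<le> pi / 2" using ts(2) nth_mem[of i ts] that unfolding m_def by blast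
    then show ?thesis by (auto simp: \<phi>_def abs_le_iff)
  qed
  \<comment> \<open>\<open>sorted_wrt\<close> compares distinct positions only, so
    \<open>i = j\<close> is a separate case.\<close>
  have anti: "\<phi> j \<le> \<phi> i" if "i \<le> j" "j < m" for i j
    using ts(1) that sorted_wrt_nth_less[of "(\<ge>)" ts i j] by (cases "i = j") (auto simp: \<phi>_def m_def)
  show ?normal_form
    by (rule exI[of _ T], rule exI[of _ \<theta>], rule exI[of _ m], rule exI[of _ k], rule exI[of _ \<phi>])
      (use T CT range anti \<open>r = m + 2 * k\<close> invertible_mat_iff_det[OF T(1)] in \<open>intro conjI; simp only:; blast\<close>)
next
  assume ?normal_form
  then show ?symmetric_sectorial
  proof (elim exE conjE)
    fix T \<theta> m k \<phi>
    assume T: "T \<in> carrier_mat n n" "invertible_mat T" and r: "r = m + 2 * k"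
      and \<phi>: "\<forall>i<m. \<theta> - pi / 2 \<le> \<phi> i \<and> \<phi> i \<le> \<theta> + pi / 2"
      and "\<forall>i j. i \<le> j \<and> j < m \<longrightarrow> \<phi> j \<le> \<phi> i"
      and C: "C = cmat T\<^sup>T * diag_block_mat [0\<^sub>m (n - r) (n - r), D_block m \<phi>, E_block \<theta> k] * cmat T"
    let ?Bs = "replicate (n - r) (0\<^sub>m 1 1) @ map phase_mat (map (\<lambda>i. \<phi> i - \<theta>) [0..<m]) @ replicate k E_cell"
    \<comment> \<open>Makes the subtraction \<open>n - r\<close> exact, so that the block sizes add
      up to \<open>n\<close>.\<close>
    have "r \<le> n" unfolding r_def using vec_space.rank_le_nc[OF assms(1)] .
    have "canonical_block (0\<^sub>m 1 1)" "canonical_block E_cell" by (auto simp: canonical_block_def)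
    moreover have "canonical_block (phase_mat (\<phi> i - \<theta>))" if "i < m" for i
    proof -
      have "\<theta> - pi / 2 \<le> \<phi> i \<and> \<phi> i \<le> \<theta> + pi / 2" using \<phi> that by blast
      then have "\<bar>\<phi> i - \<theta>\<bar> \<le> pi / 2" by linarith
      then show ?thesis unfolding canonical_block_def by blast
    qed
    ultimately have canon: "\<forall>B\<in>set ?Bs. canonical_block B" by auto
    have dB: "dim_row (phase_mat t) = 1" for t by (simp add: phase_mat_def)
    have "sum_list (map dim_row ?Bs) = n - r + (m + 2 * k)"
      by (simp add: o_def dB sum_list_replicate map_replicate_const carrier_matD[OF E_cell_carrier])
    then have dBs: "sum_list (map dim_row ?Bs) = n" using r \<open>r \<le> n\<close> by simp
    note nf = canonical_diag_block_mat[OF canon, unfolded dBs]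
    then have Bc: "diag_block_mat ?Bs \<in> carrier_mat n n" by (simp add: accretive_def)
    have dT: "det T \<noteq> 0" using T invertible_mat_iff_det by blast
    have rc: "real_congruent n (cis \<theta> \<cdot>\<^sub>m diag_block_mat ?Bs) C"
      by (rule real_congruentI[OF _ T(1) dT]) (use Bc C in \<open>simp_all only: normal_form_eq_smult smult_carrier_mat\<close>)
    have "(cis \<theta> \<cdot>\<^sub>m diag_block_mat ?Bs)\<^sup>T = cis \<theta> \<cdot>\<^sub>m diag_block_mat ?Bs"
      using nf by (simp add: transpose_smult_mat)
    then have "C\<^sup>T = C" by (rule real_congruent_symmetric[OF rc])
    moreover have "cis (- \<theta>) \<cdot>\<^sub>m (cis \<theta> \<cdot>\<^sub>m diag_block_mat ?Bs) = diag_block_mat ?Bs"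
      by (rule eq_matI) (auto simp: cis_mult simp flip: mult.assoc)
    then have "real_congruent n (diag_block_mat ?Bs) (cis (- \<theta>) \<cdot>\<^sub>m C)"
      using real_congruent_smult[OF rc, of "cis (- \<theta>)"] by simp
    then have "accretive n (cis (- \<theta>) \<cdot>\<^sub>m C)" using real_congruent_accretive nf by blast
    ultimately show ?symmetric_sectorial
      using semi_sectorial_iff_accretive[OF assms(1)] by (auto simp: complex_symmetric_def)
  qed
qed

end
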